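(* Let $k$ be an algebraically closed field, and fix an index $1 \le q \le n$. If $d$ is sufficiently large, then $$K_{p,q}\big(\mathbf{P}^n; \mathcal{O}_{\mathbf{P}^n}(d)\big) \ \ne \ 0$$ whenever $$\binom{d+q}{q} - \binom{d-1}{q} - q \ \le \ p \ \le \ \binom{d+n}{n} - \binom{d+n-q}{n-q} + \binom{n}{n-q} - q - 1.$$
   Context: Here $\mathbf{P}^n$ is projective space over $k$. Let $S = \mathrm{Sym}\, H^0(\mathbf{P}^n,\mathcal{O}_{\mathbf{P}^n}(d))$ and let $R = \bigoplus_m H^0(\mathbf{P}^n,\mathcal{O}_{\mathbf{P}^n}(md))$, viewed as a graded $S$-module with minimal graded free resolution $E_\bullet$. The vector space $K_{p,q}(\mathbf{P}^n;\mathcal{O}_{\mathbf{P}^n}(d))$ is the space of minimal generators of $E_p$ of degree $p+q$, so that $E_p = \bigoplus_q K_{p,q}\otimes_k S(-p-q)$; equivalently $K_{p,q} = \mathrm{Tor}^S_p(R,S/S_+)_{p+q}$, where $S_+$ is the irrelevant maximal ideal. *)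

theory Defs
  imports Complex_Main "HOL-Computational_Algebra.Polynomial" "HOL-Library.Poly_Mapping"
begin

text \<open>
  A polynomial over \<open>'k\<close> in variables of type \<open>'v\<close> is an element of
  \<open>('v \<Rightarrow>\<^sub>0 nat) \<Rightarrow>\<^sub>0 'k\<close>, with the ring structure of \<^theory>\<open>HOL-Library.Poly_Mapping\<close>.
  Only finitely many of the variables are used, so the rings below are given by carrier sets.
\<close>

type_synonym ('v, 'k) mpoly = "('v \<Rightarrow>\<^sub>0 nat) \<Rightarrow>\<^sub>0 'k"

definition monomial_degree :: "('v \<Rightarrow>\<^sub>0 nat) \<Rightarrow> nat"
  where "monomial_degree m = (\<Sum>v\<in>Poly_Mapping.keys m. Poly_Mapping.lookup m v)"

definition monomials :: "'v set \<Rightarrow> nat \<Rightarrow> ('v \<Rightarrow>\<^sub>0 nat) set"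
  where "monomials X e = {m. Poly_Mapping.keys m \<subseteq> X \<and> monomial_degree m = e}"

definition polynomials :: "'v set \<Rightarrow> ('v, 'k::zero) mpoly set"
  where "polynomials X = {f. \<forall>m\<in>Poly_Mapping.keys f. Poly_Mapping.keys m \<subseteq> X}"

definition forms :: "'v set \<Rightarrow> nat \<Rightarrow> ('v, 'k::zero) mpoly set"
  where "forms X e = {f. Poly_Mapping.keys f \<subseteq> monomials X e}"

text \<open>
  \<open>H\<^sup>0(P\<^sup>n, O(e))\<close> for \<open>e \<ge> 0\<close> is the space of forms of degree \<open>e\<close> in \<open>x\<^sub>0, \<dots>, x\<^sub>n\<close>.
\<close>

definition global_sections :: "nat \<Rightarrow> nat \<Rightarrow> (nat, 'k::zero) mpoly set"
  where "global_sections n e = forms {..n} e"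

text \<open>
  \<open>S = Sym H\<^sup>0(P\<^sup>n, O(d))\<close>: the monomials of degree \<open>d\<close> form a basis of \<open>H\<^sup>0(P\<^sup>n, O(d))\<close>, so
  \<open>S\<close> is the polynomial ring having one variable \<open>z\<^sub>m\<close> for each such monomial \<open>m\<close>.
\<close>

type_synonym 'k sym = "(nat \<Rightarrow>\<^sub>0 nat, 'k) mpoly"

definition Sym :: "nat \<Rightarrow> nat \<Rightarrow> 'k::zero sym set"
  where "Sym n d = polynomials (monomials {..n} d)"

definition Sym_piece :: "nat \<Rightarrow> nat \<Rightarrow> nat \<Rightarrow> 'k::zero sym set"
  where "Sym_piece n d e = forms (monomials {..n} d) e"

definition irrelevant_ideal :: "nat \<Rightarrow> nat \<Rightarrow> 'k::zero sym set"
  where "irrelevant_ideal n d = {s \<in> Sym n d. Poly_Mapping.lookup s 0 = 0}"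

text \<open>
  \<open>R = \<Oplus>\<^sub>m H\<^sup>0(P\<^sup>n, O(m d))\<close>, realised inside \<open>k[x\<^sub>0, \<dots>, x\<^sub>n]\<close>; this is a direct sum for
  \<open>d \<ge> 1\<close>. The piece of degree \<open>m\<close> is \<open>global_sections n (m * d)\<close>. An element of \<open>S\<close> acts on
  \<open>R\<close> as multiplication by its image under \<open>z\<^sub>m \<mapsto> m\<close>.
\<close>

definition section_ring :: "nat \<Rightarrow> nat \<Rightarrow> (nat, 'k::zero) mpoly set"
  where "section_ring n d = {f. Poly_Mapping.keys f \<subseteq> (\<Union>m. monomials {..n} (m * d))}"

definition Sym_to_sections :: "'k::comm_ring_1 sym \<Rightarrow> (nat, 'k) mpoly"
  where "Sym_to_sections s =
    (\<Sum>M\<in>Poly_Mapping.keys s. Poly_Mapping.single 0 (Poly_Mapping.lookup s M)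
        * (\<Prod>m\<in>Poly_Mapping.keys M. Poly_Mapping.single m 1 ^ Poly_Mapping.lookup M m))"

text \<open>
  A graded free \<open>S\<close>-module \<open>\<Oplus>\<^sub>i S(-a\<^sub>i)\<close>, where \<open>i\<close> ranges over a set \<open>B\<close> of indices of
  basis elements, consists of the finitely supported families of elements of \<open>S\<close> indexed by \<open>B\<close>.
  The degree \<open>j\<close> part of \<open>S(-a)\<close> is the degree \<open>j - a\<close> part of \<open>S\<close>.
\<close>

type_synonym 'k free = "nat \<Rightarrow>\<^sub>0 'k sym"

definition free_module :: "nat \<Rightarrow> nat \<Rightarrow> nat set \<Rightarrow> 'k::zero free set"
  where "free_module n d B = {v. Poly_Mapping.keys v \<subseteq> B \<and> (\<forall>i. Poly_Mapping.lookup v i \<in> Sym n d)}"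

definition free_piece :: "nat \<Rightarrow> nat \<Rightarrow> nat set \<Rightarrow> (nat \<Rightarrow> nat) \<Rightarrow> nat \<Rightarrow> 'k::zero free set"
  where "free_piece n d B a j =
    {v. Poly_Mapping.keys v \<subseteq> B \<and> (\<forall>i\<in>Poly_Mapping.keys v. a i \<le> j \<and> Poly_Mapping.lookup v i \<in> Sym_piece n d (j - a i))}"

definition free_smult :: "'k::comm_ring_1 sym \<Rightarrow> 'k free \<Rightarrow> 'k free"
  where "free_smult s v = Poly_Mapping.map (\<lambda>t. s * t) v"

definition Sym_linear ::
    "nat \<Rightarrow> nat \<Rightarrow> 'k::comm_ring_1 free set \<Rightarrow> ('k sym \<Rightarrow> 'm \<Rightarrow> 'm) \<Rightarrow> ('k free \<Rightarrow> 'm::plus) \<Rightarrow> bool"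
  where "Sym_linear n d F act h \<longleftrightarrow>
    (\<forall>v\<in>F. \<forall>w\<in>F. h (v + w) = h v + h w) \<and>
    (\<forall>s\<in>Sym n d. \<forall>v\<in>F. h (free_smult s v) = act s (h v))"

text \<open>
  Data of a complex \<open>\<dots> \<rightarrow> E\<^sub>2 \<rightarrow> E\<^sub>1 \<rightarrow> E\<^sub>0 \<rightarrow> R\<close> of graded free modules: \<open>gens E p\<close> indexes a
  homogeneous basis of \<open>E\<^sub>p\<close>, with degrees \<open>gdeg E p\<close>; \<open>diff E p\<close> is the map from \<open>E\<^sub>p\<^sub>+\<^sub>1\<close> to
  \<open>E\<^sub>p\<close>; and \<open>aug E\<close> is the augmentation.
\<close>

record (overloaded) ('k::zero) free_complex =
  gens :: "nat \<Rightarrow> nat set"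
  gdeg :: "nat \<Rightarrow> nat \<Rightarrow> nat"
  diff :: "nat \<Rightarrow> 'k free \<Rightarrow> 'k free"
  aug :: "'k free \<Rightarrow> (nat, 'k) mpoly"

definition term_module :: "nat \<Rightarrow> nat \<Rightarrow> 'k::zero free_complex \<Rightarrow> nat \<Rightarrow> 'k free set"
  where "term_module n d E p = free_module n d (gens E p)"

definition term_piece :: "nat \<Rightarrow> nat \<Rightarrow> 'k::zero free_complex \<Rightarrow> nat \<Rightarrow> nat \<Rightarrow> 'k free set"
  where "term_piece n d E p j = free_piece n d (gens E p) (gdeg E p) j"

definition graded_free_resolution :: "nat \<Rightarrow> nat \<Rightarrow> 'k::comm_ring_1 free_complex \<Rightarrow> bool"
  where "graded_free_resolution n d E \<longleftrightarrow>
    Sym_linear n d (term_module n d E 0) (\<lambda>s f. Sym_to_sections s * f) (aug E) \<and>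
    (\<forall>j. aug E ` term_piece n d E 0 j \<subseteq> global_sections n (j * d)) \<and>
    (\<forall>p. Sym_linear n d (term_module n d E (Suc p)) free_smult (diff E p)) \<and>
    (\<forall>p j. diff E p ` term_piece n d E (Suc p) j \<subseteq> term_piece n d E p j) \<and>
    aug E ` term_module n d E 0 = section_ring n d \<and>
    {v \<in> term_module n d E 0. aug E v = 0} = diff E 0 ` term_module n d E 1 \<and>
    (\<forall>p. {v \<in> term_module n d E (Suc p). diff E p v = 0} =
         diff E (Suc p) ` term_module n d E (Suc (Suc p)))"

text \<open>Minimality: the image of each differential lies in \<open>S\<^sub>+ E\<^sub>p\<close>.\<close>

definition minimal_graded_free_resolution :: "nat \<Rightarrow> nat \<Rightarrow> 'k::comm_ring_1 free_complex \<Rightarrow> bool"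
  where "minimal_graded_free_resolution n d E \<longleftrightarrow>
    graded_free_resolution n d E \<and>
    (\<forall>p. \<forall>v \<in> term_module n d E (Suc p). \<forall>i. Poly_Mapping.lookup (diff E p v) i \<in> irrelevant_ideal n d)"

text \<open>
  \<open>K\<^sub>p\<^sub>,\<^sub>q\<close> as the space of minimal generators of \<open>E\<^sub>p\<close> of degree \<open>p + q\<close>: the \<open>k\<close>-span of the basis
  elements of that degree, so that \<open>E\<^sub>p = \<Oplus>\<^sub>q K\<^sub>p\<^sub>,\<^sub>q \<otimes>\<^sub>k S(-p-q)\<close>. For minimal \<open>E\<close> this is
  \<open>(E\<^sub>p \<otimes>\<^sub>S S/S\<^sub>+)\<^sub>p\<^sub>+\<^sub>q\<close>.
\<close>

definition syzygy_space :: "'k::zero free_complex \<Rightarrow> nat \<Rightarrow> nat \<Rightarrow> 'k free set"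
  where "syzygy_space E p q =
    {v. Poly_Mapping.keys v \<subseteq> {i \<in> gens E p. gdeg E p i = p + q} \<and>
        (\<forall>i. \<exists>c. Poly_Mapping.lookup v i = Poly_Mapping.single 0 c)}"

end

theory Submission
  imports Defs
begin

text \<open>
  Let \<open>f\<close> be the monomial \<open>(x\<^sub>0 \<cdots> x\<^sub>q\<^sub>-\<^sub>1)\<^sup>d\<^sup>-\<^sup>1 x\<^sub>q\<^sup>q\<close> of degree \<open>q d\<close>. In \<open>R\<close> modulo the regular sequence
  \<open>x\<^sub>0\<^sup>d, \<dots>, x\<^sub>n\<^sup>d\<close>, the wedge of \<open>p\<close> monomials of degree \<open>d\<close> that annihilate \<open>f\<close>, tensored with \<open>f\<close>,
  is a Koszul cycle. If these \<open>p\<close> monomials include all divisors of \<open>f\<close> of degree \<open>d\<close>, it is not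
  a boundary, since every monomial that could produce the coefficient \<open>f\<close> occurs already in the
  wedge. The two bounds on \<open>p\<close> are the number of divisors of \<open>f\<close> and the number of monomials that
  annihilate \<open>f\<close>. Instead of passing to the quotient we lift the cycle to \<open>R\<close> explicitly, and a
  diagram chase in the double complex formed by \<open>E\<close> and the Koszul complex shows that it would
  be a boundary if \<open>E\<^sub>p\<close> had no generators of degree \<open>p + q\<close>.
\<close>

section \<open>Signs and scalar cycles in the exterior algebra\<close>

text \<open>The choice of \<open>f\<close> makes both counts explicit. All its exponents are below
  d; for the exponent q of x_q this is what d >= q + 1 secures. A divisor of \<open>f\<close>
  involves only x_0, ..., x_q. A monomial m such that no x_t^d divides m f involves only x_q, ...,
  x_n, since an exponent d - 1 leaves room for no further factor. Both sets thus consist of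
  monomials of degree d in few variables with bounds on single exponents. The powers x_t^d
  annihilate \<open>f\<close> too, but must stay out of the wedge: their exterior generators are the
  ones that correct it to a cycle over R. Such a correction involves many exterior basis elements at
  once. It stays manageable because of the multigrading: in a fixed multidegree each exterior basis
  element carries a single monomial up to a scalar, so that the cycle condition becomes a condition
  on scalars, free of polynomials. Of the symmetry of Tor only one implication is needed: if a
  degree is missing among the generators of E_p, then the Koszul cycles of that degree
  bound.\<close>

definition koszul_sign :: "'v::linorder \<Rightarrow> 'v set \<Rightarrow> 'r::comm_ring_1"
  where "koszul_sign v A = (-1) ^ card {a \<in> A. a < v}"

lemma koszul_sign_insert:
  assumes "finite A" "w \<notin> A"
  shows "koszul_sign v (insert w A) = (if w < v then - koszul_sign v A else koszul_sign v A)"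
proof -
  have "{a \<in> insert w A. a < v} = (if w < v then insert w {a \<in> A. a < v} else {a \<in> A. a < v})"
    by auto
  with assms show ?thesis by (simp add: koszul_sign_def)
qed

lemma koszul_sign_square: "koszul_sign v A * koszul_sign v A = (1 :: 'r::comm_ring_1)"
  by (simp add: koszul_sign_def flip: power_mult_distrib)

lemma koszul_sign_square_left [simp]: "koszul_sign v A * (koszul_sign v A * x) = (x :: 'r::comm_ring_1)"
  by (simp add: koszul_sign_square flip: mult.assoc)

lemma koszul_sign_min:
  assumes "\<And>a. a \<in> A \<Longrightarrow> v \<le> a"
  shows "koszul_sign v A = 1"
proof -
  have "{a \<in> A. a < v} = {}"
    using assms by (auto simp: not_less)
  then show ?thesis by (simp only: koszul_sign_def card.empty power_0)
qed

lemma koszul_sign_swap: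
  assumes "finite A" "v \<notin> A" "w \<notin> A" "v \<noteq> w"
  shows "koszul_sign w A * koszul_sign v (insert w A)
    = - (koszul_sign v A * koszul_sign w (insert v A) :: 'r::comm_ring_1)"
  using assms by (auto simp: koszul_sign_insert algebra_simps)

lemma koszul_sign_swap':
  assumes "finite A" "v \<notin> A" "w \<notin> A" "v \<noteq> w"
  shows "koszul_sign w (insert v A) * koszul_sign v (insert w A)
    = - (koszul_sign v A * koszul_sign w A :: 'r::comm_ring_1)"
  using assms by (auto simp: koszul_sign_insert algebra_simps)

text \<open>An element of the exterior algebra is encoded by its coefficients \<open>c B\<close> at
  the basis elements e_B. This is the coefficient of e_B in the product of e_v with
  \<open>c\<close>; the sign moves e_v into its place in increasing order.\<close>

definition wedge :: "'v::linorder \<Rightarrow> ('v set \<Rightarrow> 'r::comm_ring_1) \<Rightarrow> 'v set \<Rightarrow> 'r"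
  where "wedge v c B = (if v \<in> B then koszul_sign v (B - {v}) * c (B - {v}) else 0)"

text \<open>The Koszul differential with every variable set to 1: contraction with the functional
  that takes each e_v to 1.\<close>

definition scalar_differential :: "'v::linorder set \<Rightarrow> ('v set \<Rightarrow> 'r::comm_ring_1) \<Rightarrow> 'v set \<Rightarrow> 'r"
  where "scalar_differential V c B = (\<Sum>v\<in>V - B. koszul_sign v B * c (insert v B))"

text \<open>Contraction is an antiderivation with value 1 on e_v. For \<open>v\<close> in
  \<open>B\<close> the remaining terms cancel one by one because e_v and e_w anticommute
  (\<open>koszul_sign_swap'\<close>).\<close>

lemma scalar_differential_wedge:
  assumes "finite V" "v \<in> V" "B \<subseteq> V"
  shows "scalar_differential V (wedge v c) B = c B - wedge v (scalar_differential V c) B"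
proof (cases "v \<in> B")
  case False
  have "scalar_differential V (wedge v c) B
      = (\<Sum>w\<in>V - B. if w = v then koszul_sign v B * (koszul_sign v B * c B) else 0)"
    unfolding scalar_differential_def using False
    by (intro sum.cong) (auto simp: wedge_def)
  also have "\<dots> = c B"
    using assms False by simp
  finally show ?thesis
    using False by (simp add: wedge_def)
next
  case True
  define C where "C = B - {v}"
  have B: "B = insert v C" and v: "v \<notin> C" and fin: "finite C"
    using True assms by (auto simp: C_def intro: finite_subset)
  have VC: "V - C = insert v (V - B)"
    using True assms by (auto simp: C_def)
  have "wedge v (scalar_differential V c) B
      = koszul_sign v C * (\<Sum>w\<in>insert v (V - B). koszul_sign w C * c (insert w C))"
    using True VC by (simp add: wedge_def scalar_differential_def flip: C_def)
  also have "\<dots> = c B + (\<Sum>w\<in>V - B. koszul_sign v C * (koszul_sign w C * c (insert w C)))"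
    using assms True by (simp add: distrib_left sum_distrib_left B)
  also have "(\<Sum>w\<in>V - B. koszul_sign v C * (koszul_sign w C * c (insert w C)))
      = - (\<Sum>w\<in>V - B. koszul_sign w B * wedge v c (insert w B))"
    unfolding sum_negf [symmetric]
  proof (rule sum.cong)
    fix w assume w: "w \<in> V - B"
    then have "w \<noteq> v" "w \<notin> C" "insert w B - {v} = insert w C"
      using B v by auto
    then have "koszul_sign w B * wedge v c (insert w B)
        = (koszul_sign w (insert v C) * koszul_sign v (insert w C)) * c (insert w C)"
      using True B by (simp add: wedge_def mult.assoc)
    also have "\<dots> = - (koszul_sign v C * (koszul_sign w C * c (insert w C)))"
      using \<open>w \<noteq> v\<close> \<open>w \<notin> C\<close> v fin by (subst koszul_sign_swap') (simp_all add: mult.assoc)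
    finally show "koszul_sign v C * (koszul_sign w C * c (insert w C))
        = - (koszul_sign w B * wedge v c (insert w B))" by simp
  qed simp
  finally show ?thesis by (simp add: scalar_differential_def [of V "wedge v c"])
qed

text \<open>
  The product of the differences \<open>e\<^sub>a - e\<^sub>g\<^sub>(\<^sub>a\<^sub>)\<close>, where \<open>a\<close> ranges over \<open>A\<close>, in the exterior
  algebra: each factor is a cycle once all variables are set to 1.
\<close>

lemma exists_scalar_cycle:
  fixes V :: "'v::linorder set"
  assumes "finite V" "A \<subseteq> V" "g ` A \<subseteq> V" "g ` A \<inter> A = {}"
  shows "\<exists>c :: 'v set \<Rightarrow> 'r::comm_ring_1.
    (\<forall>B\<subseteq>V. scalar_differential V c B = 0) \<and> c A * c A = 1 \<and>
    (\<forall>B. c B \<noteq> 0 \<longrightarrow> (\<exists>I\<subseteq>A. inj_on g I \<and> B = (A - I) \<union> g ` I))"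
proof -
  have "finite A" using assms finite_subset by blast
  then show ?thesis using assms(2-4)
  proof (induction A)
    case empty
    show ?case
      by (rule exI[of _ "\<lambda>B. if B = {} then 1 else 0"]) (simp add: scalar_differential_def)
  next
    case (insert m A)
    obtain c :: "'v set \<Rightarrow> 'r" where cycle: "\<And>B. B \<subseteq> V \<Longrightarrow> scalar_differential V c B = 0"
      and one: "c A * c A = 1"
      and supp: "\<And>B. c B \<noteq> 0 \<Longrightarrow> \<exists>I\<subseteq>A. inj_on g I \<and> B = (A - I) \<union> g ` I"
      using insert.IH insert.prems by auto
    \<comment> \<open>The new factor is e_m - e_(g m). By the antiderivation rule its two halves
      contribute \<open>c\<close> and \<open>-c\<close> to the boundary, up to multiples of the
      boundary of \<open>c\<close>.\<close>
    define c' where "c' B = wedge m c B - wedge (g m) c B" for B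
    have "scalar_differential V c' B = 0" if B: "B \<subseteq> V" for B
    proof -
      have "scalar_differential V c' B
          = scalar_differential V (wedge m c) B - scalar_differential V (wedge (g m) c) B"
        by (simp add: scalar_differential_def c'_def right_diff_distrib sum_subtractf)
      also have "\<dots> = 0"
      proof -
        have "scalar_differential V c (B - {w}) = 0" for w using B by (intro cycle) auto
        then show ?thesis
          using scalar_differential_wedge[of V m B c] scalar_differential_wedge[of V "g m" B c]
            insert.prems assms(1) B by (simp add: wedge_def)
      qed
      finally show ?thesis .
    qed
    moreover have "c' (insert m A) * c' (insert m A) = 1"
    proof -
      have "g m \<notin> insert m A" using insert.prems by auto
      then have "c' (insert m A) = koszul_sign m A * c A"
        using insert.hyps by (simp add: c'_def wedge_def)
      then have "c' (insert m A) * c' (insert m A) = (koszul_sign m A * koszul_sign m A) * (c A * c A)"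
        by (simp only: mult_ac)
      then show ?thesis by (simp add: koszul_sign_square one)
    qed
    moreover have "\<exists>I\<subseteq>insert m A. inj_on g I \<and> B = (insert m A - I) \<union> g ` I" if "c' B \<noteq> 0" for B
    proof (cases "wedge m c B = 0")
      case False
      then have "m \<in> B" "c (B - {m}) \<noteq> 0" by (auto simp: wedge_def split: if_splits)
      then obtain I where I: "I \<subseteq> A" "inj_on g I" "B - {m} = (A - I) \<union> g ` I"
        using supp[of "B - {m}"] by metis
      have "B = insert m (B - {m})" using \<open>m \<in> B\<close> by blast
      also have "\<dots> = insert m ((A - I) \<union> g ` I)" by (simp only: I(3))
      also have "\<dots> = (insert m A - I) \<union> g ` I" using I(1) insert.hyps by blast
      finally have "B = (insert m A - I) \<union> g ` I" .
      with I show ?thesis by blast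
    next
      case True
      with that have "g m \<in> B" "c (B - {g m}) \<noteq> 0" by (auto simp: c'_def wedge_def split: if_splits)
      then obtain I where I: "I \<subseteq> A" "inj_on g I" "B - {g m} = (A - I) \<union> g ` I"
        using supp[of "B - {g m}"] by metis
      \<comment> \<open>A repeated factor e_(g m) would kill the product, so \<open>g\<close> stays
        injective on the exchanged elements.\<close>
      have "g m \<notin> g ` I" using I(3) by blast
      then have inj: "inj_on g (insert m I)" using I(2) by auto
      have "B = insert (g m) (B - {g m})" using \<open>g m \<in> B\<close> by blast
      also have "\<dots> = insert (g m) ((A - I) \<union> g ` I)" by (simp only: I(3))
      also have "\<dots> = (insert m A - insert m I) \<union> g ` insert m I" using insert.hyps by blast
      finally have B: "B = (insert m A - insert m I) \<union> g ` insert m I" .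
      show ?thesis
        by (rule exI[of _ "insert m I"]) (use I(1) inj B in blast)
    qed
    ultimately show ?case by blast
  qed
qed

section \<open>The Koszul complex of a polynomial ring\<close>

lemma lookup_single_mult:
  "Poly_Mapping.lookup (Poly_Mapping.single t c * g) k
    = c * Sum_any (\<lambda>q. Poly_Mapping.lookup g q when k = t + q)"
  by (simp add: lookup_mult lookup_single when_mult)

lemma lookup_single_mult_add [simp]:
  fixes t :: "'a::cancel_comm_monoid_add"
  shows "Poly_Mapping.lookup (Poly_Mapping.single t c * g) (t + k) = c * Poly_Mapping.lookup g k"
  by (simp add: lookup_single_mult)

lemma lookup_single_mult_eq_0:
  assumes "\<And>q. k \<noteq> t + q"
  shows "Poly_Mapping.lookup (Poly_Mapping.single t c * g) k = 0"
  using assms by (simp add: lookup_single_mult)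

lemma single_one_add_diff:
  fixes M :: "'v \<Rightarrow>\<^sub>0 nat"
  assumes "v \<in> Poly_Mapping.keys M"
  shows "Poly_Mapping.single v 1 + (M - Poly_Mapping.single v 1) = M"
  using assms by (intro poly_mapping_eqI) (auto simp: lookup_add lookup_minus lookup_single when_def in_keys_iff)

lemma keys_add_nat:
  fixes M N :: "'v \<Rightarrow>\<^sub>0 nat"
  shows "Poly_Mapping.keys (M + N) = Poly_Mapping.keys M \<union> Poly_Mapping.keys N"
  by (auto simp: in_keys_iff lookup_add)

lemma lookup_var_mult:
  fixes M :: "'v \<Rightarrow>\<^sub>0 nat"
  shows "Poly_Mapping.lookup (Poly_Mapping.single (Poly_Mapping.single v 1) c * g) M
    = (if v \<in> Poly_Mapping.keys M then c * Poly_Mapping.lookup g (M - Poly_Mapping.single v 1) else 0)"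
proof (cases "v \<in> Poly_Mapping.keys M")
  case True
  then show ?thesis
    using lookup_single_mult_add[of "Poly_Mapping.single v 1" c g "M - Poly_Mapping.single v 1"]
    by (simp only: single_one_add_diff if_True)
next
  case False
  then have "M \<noteq> Poly_Mapping.single v 1 + q" for q
    by (auto simp: keys_add_nat)
  then show ?thesis using False by (simp add: lookup_single_mult_eq_0)
qed

text \<open>The coefficient at e_A collects the coefficients at all e_v e_A. The parameter
  \<open>act\<close> lets one formula serve S, free S-modules and R. The sign is part of the acting
  scalar, so a map that respects sums and the action commutes with the differential.\<close>

definition koszul_differential ::
    "'v::linorder set \<Rightarrow> (('v, 'k::comm_ring_1) mpoly \<Rightarrow> 'm \<Rightarrow> 'm) \<Rightarrow> ('v set \<Rightarrow> 'm) \<Rightarrow> 'v set \<Rightarrow> 'm::comm_monoid_add"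
  where "koszul_differential V act \<phi> A =
    (\<Sum>v\<in>V - A. act (Poly_Mapping.single (Poly_Mapping.single v 1) (koszul_sign v A)) (\<phi> (insert v A)))"

text \<open>Division by z_v of the terms whose least variable is \<open>v\<close>; all other terms
  are dropped. The condition on \<open>M\<close> says that \<open>v\<close> is least in z_v times
  the monomial \<open>M\<close>.\<close>

lift_definition shift_down :: "'v::linorder \<Rightarrow> ('v, 'k::zero) mpoly \<Rightarrow> ('v, 'k) mpoly"
  is "\<lambda>v g M. if \<forall>u\<in>Poly_Mapping.keys M. v \<le> u then g (M + Poly_Mapping.single v (1::nat)) else 0"
proof -
  fix v and g :: "('v \<Rightarrow>\<^sub>0 nat) \<Rightarrow> 'k"
  assume "finite {x. g x \<noteq> 0}"
  then have "finite ((\<lambda>M. M + Poly_Mapping.single v 1) -` {x. g x \<noteq> 0})"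
    by (rule finite_vimageI) (auto intro: injI)
  then show "finite {M. (if \<forall>u\<in>Poly_Mapping.keys M. v \<le> u then g (M + Poly_Mapping.single v (1::nat)) else 0) \<noteq> 0}"
    by (rule rev_finite_subset) (auto split: if_splits)
qed

lemma lookup_shift_down:
  "Poly_Mapping.lookup (shift_down v g) M
    = (if \<forall>u\<in>Poly_Mapping.keys M. v \<le> u then Poly_Mapping.lookup g (M + Poly_Mapping.single v 1) else 0)"
  by transfer simp

lemma shift_down_0 [simp]: "shift_down v 0 = 0"
  by (rule poly_mapping_eqI) (simp add: lookup_shift_down)

lemma shift_down_polynomials:
  assumes "g \<in> polynomials V"
  shows "shift_down v g \<in> polynomials V"
proof -
  have "Poly_Mapping.keys M \<subseteq> V" if "M \<in> Poly_Mapping.keys (shift_down v g)" for M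
  proof -
    have "M + Poly_Mapping.single v 1 \<in> Poly_Mapping.keys g"
      using that by (auto simp: in_keys_iff lookup_shift_down split: if_splits)
    then have "Poly_Mapping.keys (M + Poly_Mapping.single v 1) \<subseteq> V"
      using assms by (auto simp: polynomials_def)
    then show ?thesis by (simp add: keys_add_nat)
  qed
  then show ?thesis by (auto simp: polynomials_def)
qed

text \<open>
  The contracting homotopy: it replaces \<open>z\<^sub>v\<close> by \<open>e\<^sub>v\<close>, where \<open>v\<close> is the least variable that
  occurs in a basis element, and kills the basis element if \<open>e\<^sub>v\<close> occurs already.
\<close>

definition koszul_homotopy :: "('v::linorder set \<Rightarrow> ('v, 'k::zero) mpoly) \<Rightarrow> 'v set \<Rightarrow> ('v, 'k) mpoly"
  where "koszul_homotopy \<phi> B = (if B = {} then 0 else shift_down (Min B) (\<phi> (B - {Min B})))"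

lemma koszul_homotopy_polynomials:
  assumes "finite V" "B \<subseteq> V" "\<And>A. A \<subseteq> V \<Longrightarrow> \<phi> A \<in> polynomials V"
  shows "koszul_homotopy \<phi> B \<in> polynomials V"
proof (cases "B = {}")
  case True
  then show ?thesis by (simp add: koszul_homotopy_def polynomials_def)
next
  case False
  have "B - {Min B} \<subseteq> V" using assms by auto
  with False assms show ?thesis
    by (simp add: koszul_homotopy_def shift_down_polynomials)
qed

lemma lookup_koszul_differential:
  assumes "finite V"
  shows "Poly_Mapping.lookup (koszul_differential V (*) \<phi> A) M
    = (\<Sum>v\<in>(V - A) \<inter> Poly_Mapping.keys M.
        koszul_sign v A * Poly_Mapping.lookup (\<phi> (insert v A)) (M - Poly_Mapping.single v 1))"
  using assms unfolding koszul_differential_def lookup_sum lookup_var_mult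
  by (subst sum.inter_restrict) auto

text \<open>Compare coefficients at the basis element z^M e_A, according to where its least variable
  sits. If it lies in \<open>A\<close>, the cycle equation at a neighbouring basis element gives the
  claim; otherwise a single term of the sum survives. Only the basis element 1 has no variable at
  all, which is why \<open>const\<close> is required.\<close>

lemma koszul_exact:
  fixes V :: "'v::linorder set" and \<phi> :: "'v set \<Rightarrow> ('v, 'k::comm_ring_1) mpoly"
  assumes fin: "finite V" and A: "A \<subseteq> V"
    and poly: "\<And>A. A \<subseteq> V \<Longrightarrow> \<phi> A \<in> polynomials V"
    and cycle: "\<And>A. A \<subseteq> V \<Longrightarrow> koszul_differential V (*) \<phi> A = 0"
    and const: "Poly_Mapping.lookup (\<phi> {}) 0 = 0"
  shows "koszul_differential V (*) (koszul_homotopy \<phi>) A = \<phi> A"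
proof (rule poly_mapping_eqI)
  fix M
  let ?L = "\<lambda>v. koszul_sign v A * Poly_Mapping.lookup (koszul_homotopy \<phi> (insert v A)) (M - Poly_Mapping.single v 1)"
  let ?W = "(V - A) \<inter> Poly_Mapping.keys M"
  have finA: "finite A" using A fin finite_subset by blast
  have finW: "finite ?W" using fin by auto
  have "(\<Sum>v\<in>?W. ?L v) = Poly_Mapping.lookup (\<phi> A) M"
  proof (cases "Poly_Mapping.keys M \<subseteq> V")
    case False
    have zero: "Poly_Mapping.lookup g N = 0" if "g \<in> polynomials V" "\<not> Poly_Mapping.keys N \<subseteq> V" for g :: "('v, 'k) mpoly" and N
      using that by (auto simp: polynomials_def in_keys_iff)
    have "?L v = 0" if "v \<in> ?W" for v
    proof -
      have "Poly_Mapping.keys M = insert v (Poly_Mapping.keys (M - Poly_Mapping.single v 1))"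
        using that single_one_add_diff[of v M] keys_add_nat[of "Poly_Mapping.single v 1" "M - Poly_Mapping.single v 1"]
        by simp
      with False that have "\<not> Poly_Mapping.keys (M - Poly_Mapping.single v 1) \<subseteq> V" by auto
      moreover have "koszul_homotopy \<phi> (insert v A) \<in> polynomials V"
        using that A by (intro koszul_homotopy_polynomials fin poly) auto
      ultimately show ?thesis using zero by simp
    qed
    moreover have "Poly_Mapping.lookup (\<phi> A) M = 0" using zero poly A False by blast
    ultimately show ?thesis by simp
  next
    case M: True
    show ?thesis
    proof (cases "A \<noteq> {} \<and> (\<forall>w\<in>Poly_Mapping.keys M. Min A \<le> w)")
      case True
      define u where "u = Min A"
      define C where "C = A - {u}"
      have u: "u \<in> A" and le: "\<And>a. a \<in> A \<Longrightarrow> u \<le> a" and leM: "\<And>w. w \<in> Poly_Mapping.keys M \<Longrightarrow> u \<le> w"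
        using True finA by (auto simp: u_def)
      have AC: "A = insert u C" and uC: "u \<notin> C" and uV: "u \<in> V" and finC: "finite C"
        using u A finA by (auto simp: C_def)
      \<comment> \<open>In the cycle equation at e_C and z_u z^M, the term for \<open>u\<close> is
        the coefficient sought, and the other terms are those of \<open>?L\<close> with opposite
        sign, as e_u precedes e_v.\<close>
      define N where "N = M + Poly_Mapping.single u 1"
      have ltW: "u < v" if "v \<in> ?W" for v
        using that u leM[of v] by (auto simp: order_le_less)
      have W: "(V - C) \<inter> Poly_Mapping.keys N = insert u ?W"
        using uC uV AC by (auto simp: N_def keys_add_nat)
      have "0 = Poly_Mapping.lookup (koszul_differential V (*) \<phi> C) N"
        using cycle[of C] A AC by auto
      also have "\<dots> = Poly_Mapping.lookup (\<phi> A) M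
          + (\<Sum>v\<in>?W. koszul_sign v C * Poly_Mapping.lookup (\<phi> (insert v C)) (N - Poly_Mapping.single v 1))"
        using finW u le AC unfolding lookup_koszul_differential[OF fin] W
        by (simp add: koszul_sign_min N_def)
      also have "(\<Sum>v\<in>?W. koszul_sign v C * Poly_Mapping.lookup (\<phi> (insert v C)) (N - Poly_Mapping.single v 1))
          = - (\<Sum>v\<in>?W. ?L v)"
        unfolding sum_negf [symmetric]
      proof (rule sum.cong)
        fix v assume v: "v \<in> ?W"
        then have uv: "u < v" by (rule ltW)
        have ins: "Min (insert v A) = u"
          using finA u le uv by (intro Min_eqI) auto
        have ins': "insert v A - {u} = insert v C"
          using uv AC uC by auto
        have keys: "\<forall>w\<in>Poly_Mapping.keys (M - Poly_Mapping.single v 1). u \<le> w"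
          using leM single_one_add_diff[of v M] v
          by (metis Int_iff Un_iff keys_add_nat)
        have "M - Poly_Mapping.single v 1 + Poly_Mapping.single u 1 = N - Poly_Mapping.single v 1"
          using v uv by (intro poly_mapping_eqI)
            (auto simp: N_def lookup_add lookup_minus lookup_single when_def in_keys_iff)
        then have "Poly_Mapping.lookup (koszul_homotopy \<phi> (insert v A)) (M - Poly_Mapping.single v 1)
            = Poly_Mapping.lookup (\<phi> (insert v C)) (N - Poly_Mapping.single v 1)"
          using keys by (simp add: koszul_homotopy_def ins ins' lookup_shift_down)
        moreover have "koszul_sign v A = - (koszul_sign v C :: 'k)"
          unfolding AC using uv uC finC by (simp add: koszul_sign_insert)
        ultimately show "koszul_sign v C * Poly_Mapping.lookup (\<phi> (insert v C)) (N - Poly_Mapping.single v 1) = - ?L v"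
          by simp
      qed simp
      finally show ?thesis by simp
    next
      case False
      show ?thesis
      proof (cases "M = 0")
        case True
        with False have "A = {}" by auto
        with True const show ?thesis by simp
      next
        case M0: False
        define w where "w = Min (Poly_Mapping.keys M)"
        have wM: "w \<in> Poly_Mapping.keys M" and wle: "\<And>v. v \<in> Poly_Mapping.keys M \<Longrightarrow> w \<le> v"
          using M0 by (auto simp: w_def intro!: Min_in)
        have wA: "w < a" if "a \<in> A" for a
        proof -
          have "A \<noteq> {}" using that by auto
          then obtain v where "v \<in> Poly_Mapping.keys M" "v < Min A"
            using False by (auto simp: not_le)
          then have "w < Min A" using wle by (meson le_less_trans)
          also have "Min A \<le> a" using that finA by simp
          finally show ?thesis .
        qed
        then have "w \<notin> A" by auto
        with wM M have wW: "w \<in> ?W" by auto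
        \<comment> \<open>After division by z_v the variable \<open>w\<close> still occurs and lies
          below every index in the wedge, so \<open>shift_down\<close> drops the term.\<close>
        have "?L v = 0" if v: "v \<in> ?W" "v \<noteq> w" for v
        proof -
          have "w < v" using v wle[of v] by auto
          have "Min (insert v A) \<in> insert v A" using finA by (intro Min_in) auto
          then have "w < Min (insert v A)" using wA \<open>w < v\<close> by auto
          moreover have "w \<in> Poly_Mapping.keys (M - Poly_Mapping.single v 1)"
            using wM v by (auto simp: in_keys_iff lookup_minus lookup_single)
          ultimately show ?thesis by (auto simp: koszul_homotopy_def lookup_shift_down)
        qed
        then have "(\<Sum>v\<in>?W. ?L v) = ?L w"
          using wW finW by (subst sum.remove[of _ w]) auto
        also have "\<dots> = Poly_Mapping.lookup (\<phi> A) M"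
        proof -
          have min: "Min (insert w A) = w" using finA wA by (intro Min_eqI) (auto intro: less_imp_le)
          have keys: "\<forall>v\<in>Poly_Mapping.keys (M - Poly_Mapping.single w 1). w \<le> v"
            using wle single_one_add_diff[of w M] wM by (metis Un_iff keys_add_nat)
          have "koszul_sign w A = (1 :: 'k)"
            using wA by (intro koszul_sign_min) (auto intro: less_imp_le)
          moreover have "M - Poly_Mapping.single w 1 + Poly_Mapping.single w 1 = M"
            using single_one_add_diff[OF wM] by (simp add: add.commute)
          ultimately show ?thesis using min keys \<open>w \<notin> A\<close>
            by (simp add: koszul_homotopy_def lookup_shift_down)
        qed
        finally show ?thesis .
      qed
    qed
  qed
  then show "Poly_Mapping.lookup (koszul_differential V (*) (koszul_homotopy \<phi>) A) M = Poly_Mapping.lookup (\<phi> A) M"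
    by (simp only: lookup_koszul_differential[OF fin])
qed

text \<open>Pairs cancel by induction on \<open>W\<close>. Swapping the two summations would show
  only that twice the sum is 0, which is too weak in characteristic 2.\<close>

lemma sum_antisymmetric_eq_0:
  fixes T :: "'a \<Rightarrow> 'a \<Rightarrow> 'b::ab_group_add"
  assumes "finite W" "\<And>v w. v \<in> W \<Longrightarrow> w \<in> W \<Longrightarrow> v \<noteq> w \<Longrightarrow> T w v = - T v w"
  shows "(\<Sum>v\<in>W. \<Sum>w\<in>W - {v}. T v w) = 0"
  using assms
proof (induction W)
  case (insert u W)
  have "(\<Sum>w\<in>insert u W - {v}. T v w) = T v u + (\<Sum>w\<in>W - {v}. T v w)" if "v \<in> W" for v
  proof -
    have "insert u W - {v} = insert u (W - {v})" using that insert.hyps by auto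
    then show ?thesis using insert.hyps by simp
  qed
  then have "(\<Sum>v\<in>W. \<Sum>w\<in>insert u W - {v}. T v w) = (\<Sum>v\<in>W. T v u) + (\<Sum>v\<in>W. \<Sum>w\<in>W - {v}. T v w)"
    by (simp add: sum.distrib)
  also have "(\<Sum>v\<in>W. \<Sum>w\<in>W - {v}. T v w) = 0"
    by (rule insert.IH) (rule insert.prems; simp)
  also have "(\<Sum>v\<in>W. T v u) = - (\<Sum>v\<in>W. T u v)"
    unfolding sum_negf [symmetric] using insert.hyps by (intro sum.cong refl insert.prems) auto
  finally show ?case using insert.hyps by simp
qed simp

lemma koszul_differential_square:
  fixes \<phi> :: "'v::linorder set \<Rightarrow> ('v, 'k::comm_ring_1) mpoly"
  assumes fin: "finite V" and A: "A \<subseteq> V"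
  shows "koszul_differential V (*) (koszul_differential V (*) \<phi>) A = 0"
proof -
  define T :: "'v \<Rightarrow> 'v \<Rightarrow> ('v, 'k) mpoly" where
    "T v w = Poly_Mapping.single (Poly_Mapping.single v 1) (koszul_sign v A)
      * (Poly_Mapping.single (Poly_Mapping.single w 1) (koszul_sign w (insert v A)) * \<phi> (insert w (insert v A)))" for v w
  have "koszul_differential V (*) (koszul_differential V (*) \<phi>) A = (\<Sum>v\<in>V - A. \<Sum>w\<in>(V - A) - {v}. T v w)"
    unfolding koszul_differential_def sum_distrib_left T_def
    by (intro sum.cong) auto
  also have "\<dots> = 0"
  proof (rule sum_antisymmetric_eq_0)
    fix v w assume vw: "v \<in> V - A" "w \<in> V - A" "v \<noteq> w"
    have sign: "koszul_sign w A * koszul_sign v (insert w A) = - (koszul_sign v A * koszul_sign w (insert v A) :: 'k)"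
      using vw A fin finite_subset by (intro koszul_sign_swap) auto
    have T: "T a b = Poly_Mapping.single (Poly_Mapping.single a 1 + Poly_Mapping.single b 1)
        (koszul_sign a A * koszul_sign b (insert a A)) * \<phi> (insert b (insert a A))" for a b
      unfolding T_def by (simp only: mult_single flip: mult.assoc)
    have "T w v = Poly_Mapping.single (Poly_Mapping.single v 1 + Poly_Mapping.single w 1)
        (- (koszul_sign v A * koszul_sign w (insert v A))) * \<phi> (insert w (insert v A))"
      unfolding T sign by (simp only: add.commute insert_commute)
    then show "T w v = - T v w"
      by (simp only: T[of v w] single_uminus mult_minus_left)
  qed (use fin in auto)
  finally show ?thesis .
qed

section \<open>Graded free modules\<close>

lemma polynomials_0 [simp]: "0 \<in> polynomials X"
  by (simp add: polynomials_def)

lemma polynomials_add: "f \<in> polynomials X \<Longrightarrow> g \<in> polynomials X \<Longrightarrow> f + g \<in> polynomials X"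
  using Poly_Mapping.keys_add[of f g] by (auto simp: polynomials_def)

lemma polynomials_diff:
  fixes f g :: "('v, 'k::ab_group_add) mpoly"
  shows "f \<in> polynomials X \<Longrightarrow> g \<in> polynomials X \<Longrightarrow> f - g \<in> polynomials X"
  using keys_diff[of f g] by (auto simp: polynomials_def)

lemma polynomials_mult:
  assumes "f \<in> polynomials X" "g \<in> polynomials X"
  shows "f * g \<in> polynomials X"
  unfolding polynomials_def
proof (intro CollectI ballI)
  fix M assume "M \<in> Poly_Mapping.keys (f * g)"
  then obtain a b where "a \<in> Poly_Mapping.keys f" "b \<in> Poly_Mapping.keys g" "M = a + b"
    using keys_mult[of f g] by blast
  then show "Poly_Mapping.keys M \<subseteq> X" using assms by (auto simp: polynomials_def keys_add_nat)
qed

lemma polynomials_var: "v \<in> X \<Longrightarrow> Poly_Mapping.single (Poly_Mapping.single v 1) c \<in> polynomials X"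
  by (auto simp: polynomials_def split: if_splits)

lemma monomial_degree_add: "monomial_degree (M + N) = monomial_degree M + monomial_degree N"
  unfolding monomial_degree_def by (rule setsum_keys_plus_distrib) simp_all

lemma monomial_degree_single [simp]: "monomial_degree (Poly_Mapping.single v e) = e"
  by (simp add: monomial_degree_def)

lemma forms_polynomials: "f \<in> forms X e \<Longrightarrow> f \<in> polynomials X"
  by (auto simp: forms_def polynomials_def monomials_def)

lemma forms_var_mult:
  assumes "v \<in> X" "g \<in> forms X e"
  shows "Poly_Mapping.single (Poly_Mapping.single v 1) c * g \<in> forms X (Suc e)"
  unfolding forms_def
proof (intro CollectI subsetI)
  fix M assume "M \<in> Poly_Mapping.keys (Poly_Mapping.single (Poly_Mapping.single v 1) c * g)"
  then obtain b where b: "b \<in> Poly_Mapping.keys g" "M = Poly_Mapping.single v 1 + b"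
    using keys_mult[of "Poly_Mapping.single (Poly_Mapping.single v 1) c" g] by (auto split: if_splits)
  then have "b \<in> monomials X e" using assms by (auto simp: forms_def)
  then show "M \<in> monomials X (Suc e)"
    using assms(1) b by (auto simp: monomials_def monomial_degree_add keys_add_nat)
qed

lemma lookup_free_smult [simp]:
  "Poly_Mapping.lookup (free_smult s v) i = s * Poly_Mapping.lookup v i"
  by (simp add: free_smult_def Poly_Mapping.map.rep_eq when_def)

lemma free_module_0 [simp]: "0 \<in> free_module n d B"
  by (simp add: free_module_def Sym_def)

lemma free_module_add: "v \<in> free_module n d B \<Longrightarrow> w \<in> free_module n d B \<Longrightarrow> v + w \<in> free_module n d B"
  using Poly_Mapping.keys_add[of v w] by (auto simp: free_module_def Sym_def lookup_add polynomials_add)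

lemma free_module_diff:
  fixes v w :: "'k::ab_group_add free"
  assumes "v \<in> free_module n d B" "w \<in> free_module n d B"
  shows "v - w \<in> free_module n d B"
proof -
  have "Poly_Mapping.keys (v - w) \<subseteq> Poly_Mapping.keys v \<union> Poly_Mapping.keys w"
    by (rule keys_diff)
  with assms show ?thesis by (auto simp: free_module_def Sym_def lookup_minus polynomials_diff)
qed

lemma free_module_sum:
  "(\<And>i. i \<in> I \<Longrightarrow> f i \<in> free_module n d B) \<Longrightarrow> (\<Sum>i\<in>I. f i) \<in> free_module n d B"
  by (induction I rule: infinite_finite_induct) (auto simp: free_module_add)

lemma free_module_smult:
  assumes "s \<in> Sym n d" "v \<in> free_module n d B"
  shows "free_smult s v \<in> free_module n d B"
proof -
  have "Poly_Mapping.keys (free_smult s v) \<subseteq> Poly_Mapping.keys v"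
    by (auto simp: in_keys_iff)
  with assms show ?thesis by (auto simp: free_module_def Sym_def polynomials_mult)
qed

lemma free_piece_free_module:
  assumes "v \<in> free_piece n d B a j"
  shows "v \<in> free_module n d B"
  unfolding free_module_def
proof (intro CollectI conjI allI)
  show "Poly_Mapping.keys v \<subseteq> B" using assms by (auto simp: free_piece_def)
  fix i show "Poly_Mapping.lookup v i \<in> Sym n d"
  proof (cases "i \<in> Poly_Mapping.keys v")
    case True
    with assms show ?thesis unfolding Sym_def by (auto simp: free_piece_def Sym_piece_def intro: forms_polynomials)
  next
    case False
    then show ?thesis by (simp add: Sym_def in_keys_iff)
  qed
qed

lemma forms_0 [simp]: "0 \<in> forms X e"
  by (simp add: forms_def)

lemma forms_add: "f \<in> forms X e \<Longrightarrow> g \<in> forms X e \<Longrightarrow> f + g \<in> forms X e"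
  using Poly_Mapping.keys_add[of f g] by (auto simp: forms_def)

lemma free_piece_0 [simp]: "0 \<in> free_piece n d B a j"
  by (simp add: free_piece_def)

lemma free_piece_add:
  assumes "v \<in> free_piece n d B a j" "w \<in> free_piece n d B a j"
  shows "v + w \<in> free_piece n d B a j"
proof -
  have *: "Poly_Mapping.lookup u i \<in> forms (monomials {..n} d) (j - a i)" if "u \<in> free_piece n d B a j" for u :: "'a free" and i
    using that by (cases "i \<in> Poly_Mapping.keys u") (auto simp: free_piece_def Sym_piece_def in_keys_iff)
  have "Poly_Mapping.keys (v + w) \<subseteq> Poly_Mapping.keys v \<union> Poly_Mapping.keys w"
    by (rule Poly_Mapping.keys_add)
  then have "i \<in> B \<and> a i \<le> j" if "i \<in> Poly_Mapping.keys (v + w)" for i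
    using that assms unfolding free_piece_def by blast
  then show ?thesis
    by (auto simp: free_piece_def Sym_piece_def lookup_add intro!: forms_add *[OF assms(1)] *[OF assms(2)])
qed

lemma free_piece_sum:
  "(\<And>i. i \<in> I \<Longrightarrow> f i \<in> free_piece n d B a j) \<Longrightarrow> (\<Sum>i\<in>I. f i) \<in> free_piece n d B a j"
  by (induction I rule: infinite_finite_induct) (auto simp: free_piece_add)

lemma free_piece_var_smult:
  assumes "v \<in> monomials {..n} d" "x \<in> free_piece n d B a j"
  shows "free_smult (Poly_Mapping.single (Poly_Mapping.single v 1) c) x \<in> free_piece n d B a (Suc j)"
proof -
  have "Poly_Mapping.keys (free_smult (Poly_Mapping.single (Poly_Mapping.single v 1) c) x) \<subseteq> Poly_Mapping.keys x"
    by (auto simp: in_keys_iff)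
  then have *: "i \<in> B \<and> a i \<le> j \<and> Poly_Mapping.lookup x i \<in> forms (monomials {..n} d) (j - a i)"
    if "i \<in> Poly_Mapping.keys (free_smult (Poly_Mapping.single (Poly_Mapping.single v 1) c) x)" for i
    using that assms(2) unfolding free_piece_def Sym_piece_def by blast
  show ?thesis
    unfolding free_piece_def Sym_piece_def
  proof (intro CollectI conjI ballI subsetI)
    fix i assume "i \<in> Poly_Mapping.keys (free_smult (Poly_Mapping.single (Poly_Mapping.single v 1) c) x)"
    note i = *[OF this]
    from i show "i \<in> B" "a i \<le> Suc j" by auto
    from i have "Suc j - a i = Suc (j - a i)" by (simp add: Suc_diff_le)
    then show "Poly_Mapping.lookup (free_smult (Poly_Mapping.single (Poly_Mapping.single v 1) c) x) i
        \<in> forms (monomials {..n} d) (Suc j - a i)"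
      unfolding lookup_free_smult using i assms(1) forms_var_mult by metis
  qed
qed

lemma koszul_differential_free_module:
  assumes "\<And>A. A \<subseteq> monomials {..n} d \<Longrightarrow> \<phi> A \<in> free_module n d B" "A \<subseteq> monomials {..n} d"
  shows "koszul_differential (monomials {..n} d) free_smult \<phi> A \<in> free_module n d B"
  unfolding koszul_differential_def
proof (intro free_module_sum free_module_smult)
  fix v assume v: "v \<in> monomials {..n} d - A"
  then show "Poly_Mapping.single (Poly_Mapping.single v 1) (koszul_sign v A) \<in> Sym n d"
    unfolding Sym_def by (intro polynomials_var) simp
  show "\<phi> (insert v A) \<in> free_module n d B" using v assms by simp
qed

lemma koszul_differential_free_piece:
  assumes "\<And>A. A \<subseteq> monomials {..n} d \<Longrightarrow> \<phi> A \<in> free_piece n d B a j" "A \<subseteq> monomials {..n} d"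
  shows "koszul_differential (monomials {..n} d) free_smult \<phi> A \<in> free_piece n d B a (Suc j)"
  unfolding koszul_differential_def using assms
  by (intro free_piece_sum free_piece_var_smult) auto

lemma lookup_koszul_differential_free:
  "Poly_Mapping.lookup (koszul_differential V free_smult \<phi> A) i
    = koszul_differential V (*) (\<lambda>A. Poly_Mapping.lookup (\<phi> A) i) A"
  by (simp add: koszul_differential_def lookup_sum)

lemma koszul_differential_square_free:
  "finite V \<Longrightarrow> A \<subseteq> V \<Longrightarrow> koszul_differential V free_smult (koszul_differential V free_smult \<phi>) A = 0"
  by (rule poly_mapping_eqI)
    (simp add: lookup_koszul_differential_free koszul_differential_square)

lemma koszul_differential_cong:
  "(\<And>v. v \<in> V \<Longrightarrow> \<phi> (insert v A) = \<psi> (insert v A)) \<Longrightarrow> koszul_differential V act \<phi> A = koszul_differential V act \<psi> A"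
  by (simp add: koszul_differential_def)

text \<open>A free module is a sum of copies of S, and the homotopy is applied to every coordinate
  at once. \<open>Poly_Mapping.map\<close> keeps the family finitely supported.\<close>

lemma koszul_exact_free:
  fixes n d :: nat and \<phi> :: "(nat \<Rightarrow>\<^sub>0 nat) set \<Rightarrow> 'k::comm_ring_1 free"
  defines "V \<equiv> monomials {..n} d"
  assumes fin: "finite V"
    and mem: "\<And>A. A \<subseteq> V \<Longrightarrow> \<phi> A \<in> free_module n d B"
    and cycle: "\<And>A. A \<subseteq> V \<Longrightarrow> koszul_differential V free_smult \<phi> A = 0"
    and const: "\<And>i. Poly_Mapping.lookup (Poly_Mapping.lookup (\<phi> {}) i) 0 = 0"
  shows "\<exists>w. \<forall>A\<subseteq>V. w A \<in> free_module n d B \<and> koszul_differential V free_smult w A = \<phi> A"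
proof -
  define w where "w A = (if A = {} then 0 else Poly_Mapping.map (shift_down (Min A)) (\<phi> (A - {Min A})))" for A
  have w: "Poly_Mapping.lookup (w A) i = koszul_homotopy (\<lambda>A. Poly_Mapping.lookup (\<phi> A) i) A" for A i
    by (auto simp: w_def koszul_homotopy_def Poly_Mapping.map.rep_eq when_def)
  have poly: "Poly_Mapping.lookup (\<phi> A) i \<in> polynomials V" if "A \<subseteq> V" for A i
    using mem[OF that] by (auto simp: free_module_def Sym_def V_def)
  have "w A \<in> free_module n d B \<and> koszul_differential V free_smult w A = \<phi> A" if A: "A \<subseteq> V" for A
  proof
    have "Poly_Mapping.keys (w A) \<subseteq> B"
    proof (cases "A = {}")
      case False
      have "Poly_Mapping.keys (w A) \<subseteq> Poly_Mapping.keys (\<phi> (A - {Min A}))"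
        using False by (auto simp: w_def in_keys_iff Poly_Mapping.map.rep_eq when_def)
      also have "\<dots> \<subseteq> B" using mem[of "A - {Min A}"] A by (auto simp: free_module_def)
      finally show ?thesis .
    qed (simp add: w_def)
    moreover have "Poly_Mapping.lookup (w A) i \<in> Sym n d" for i
      using koszul_homotopy_polynomials[OF fin A poly] by (simp add: w Sym_def V_def)
    ultimately show "w A \<in> free_module n d B" by (simp add: free_module_def)
    have "koszul_differential V (*) (\<lambda>A. Poly_Mapping.lookup (\<phi> A) i) A = 0" if "A \<subseteq> V" for A i
      using cycle[OF that] by (simp flip: lookup_koszul_differential_free)
    then show "koszul_differential V free_smult w A = \<phi> A"
      by (intro poly_mapping_eqI) (simp add: lookup_koszul_differential_free w koszul_exact fin A poly const)
  qed
  then show ?thesis by blast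
qed

section \<open>Linear maps of free modules and the Koszul differential\<close>

lemma Sym_linear_diff:
  fixes h :: "'k::comm_ring_1 free \<Rightarrow> 'm::ab_group_add"
  assumes "Sym_linear n d (free_module n d B) act h" "v \<in> free_module n d B" "w \<in> free_module n d B"
  shows "h (v - w) = h v - h w"
proof -
  have "h ((v - w) + w) = h (v - w) + h w"
    using assms free_module_diff unfolding Sym_linear_def by blast
  then show ?thesis by simp
qed

lemma Sym_linear_0:
  fixes h :: "'k::comm_ring_1 free \<Rightarrow> 'm::ab_group_add"
  assumes "Sym_linear n d (free_module n d B) act h"
  shows "h 0 = 0"
  using Sym_linear_diff[OF assms, of 0 0] by simp

lemma Sym_linear_sum:
  fixes h :: "'k::comm_ring_1 free \<Rightarrow> 'm::ab_group_add"
  assumes h: "Sym_linear n d (free_module n d B) act h" and "\<And>i. i \<in> I \<Longrightarrow> f i \<in> free_module n d B"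
  shows "h (\<Sum>i\<in>I. f i) = (\<Sum>i\<in>I. h (f i))"
  using assms(2)
proof (induction I rule: infinite_finite_induct)
  case (insert x I)
  then have "f x \<in> free_module n d B" "(\<Sum>i\<in>I. f i) \<in> free_module n d B"
    by (auto intro!: free_module_sum)
  then have "h (f x + (\<Sum>i\<in>I. f i)) = h (f x) + h (\<Sum>i\<in>I. f i)"
    using h by (auto simp: Sym_linear_def)
  with insert show ?case by simp
qed (simp_all add: Sym_linear_0[OF h])

text \<open>The Koszul differential is built from sums and multiplications by variables, both
  respected by \<open>h\<close>. These are the commuting squares of the double complex.\<close>

lemma Sym_linear_koszul:
  fixes n d :: nat and h :: "'k::comm_ring_1 free \<Rightarrow> 'm::ab_group_add"
  defines "V \<equiv> monomials {..n} d"
  assumes h: "Sym_linear n d (free_module n d B) act h"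
    and "\<And>A. A \<subseteq> V \<Longrightarrow> \<phi> A \<in> free_module n d B" "A \<subseteq> V"
  shows "h (koszul_differential V free_smult \<phi> A) = koszul_differential V act (\<lambda>A. h (\<phi> A)) A"
proof -
  have S: "Poly_Mapping.single (Poly_Mapping.single v 1) c \<in> Sym n d" if "v \<in> V" for v and c :: 'k
    using that unfolding Sym_def V_def by (rule polynomials_var)
  have \<phi>: "\<phi> (insert v A) \<in> free_module n d B" if "v \<in> V" for v
    using that assms by auto
  have "h (koszul_differential V free_smult \<phi> A)
      = (\<Sum>v\<in>V - A. h (free_smult (Poly_Mapping.single (Poly_Mapping.single v 1) (koszul_sign v A)) (\<phi> (insert v A))))"
    unfolding koszul_differential_def
    by (rule Sym_linear_sum[OF h]) (use S \<phi> in \<open>auto intro!: free_module_smult\<close>)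
  also have "\<dots> = koszul_differential V act (\<lambda>A. h (\<phi> A)) A"
    using h S \<phi> unfolding koszul_differential_def Sym_linear_def by (intro sum.cong) auto
  finally show ?thesis .
qed

lemma koszul_differential_diff_free:
  fixes \<phi> \<psi> :: "(nat \<Rightarrow>\<^sub>0 nat) set \<Rightarrow> 'b::comm_ring_1 free"
  shows "koszul_differential V free_smult (\<lambda>A. \<phi> A - \<psi> A) A
    = koszul_differential V free_smult \<phi> A - koszul_differential V free_smult \<psi> A"
proof -
  have "free_smult s (x - y) = free_smult s x - free_smult s y" for s :: "'b sym" and x y
    by (rule poly_mapping_eqI) (simp add: lookup_minus right_diff_distrib)
  then show ?thesis by (simp only: koszul_differential_def sum_subtractf)
qed

subsection \<open>Homogeneous parts\<close>

definition form_part :: "nat \<Rightarrow> ('v, 'k::zero) mpoly \<Rightarrow> ('v, 'k) mpoly"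
  where "form_part e f = Poly_Mapping.mapp (\<lambda>M c. if monomial_degree M = e then c else 0) f"

lemma lookup_form_part:
  "Poly_Mapping.lookup (form_part e f) M = (if monomial_degree M = e then Poly_Mapping.lookup f M else 0)"
  by (auto simp: form_part_def lookup_mapp when_def in_keys_iff)

lemma form_part_forms:
  assumes "f \<in> forms X e'"
  shows "form_part e f = (if e = e' then f else 0)"
proof (rule poly_mapping_eqI)
  fix M
  have "monomial_degree M = e'" if "Poly_Mapping.lookup f M \<noteq> 0"
    using assms that by (auto simp: forms_def monomials_def in_keys_iff)
  then show "Poly_Mapping.lookup (form_part e f) M = Poly_Mapping.lookup (if e = e' then f else 0) M"
    by (auto simp: lookup_form_part)
qed

lemma form_part_in_forms:
  assumes "f \<in> polynomials X"
  shows "form_part e f \<in> forms X e"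
  using assms by (auto simp: forms_def polynomials_def monomials_def in_keys_iff lookup_form_part split: if_splits)

lemma form_part_add: "form_part e (f + g) = form_part e f + form_part e g"
  by (rule poly_mapping_eqI) (simp add: lookup_form_part lookup_add)

lemma form_part_0 [simp]: "form_part e 0 = 0"
  by (rule poly_mapping_eqI) (simp add: lookup_form_part)

definition free_part :: "(nat \<Rightarrow> nat) \<Rightarrow> nat \<Rightarrow> 'k::zero free \<Rightarrow> 'k free"
  where "free_part a j v = Poly_Mapping.mapp (\<lambda>i s. if a i \<le> j then form_part (j - a i) s else 0) v"

lemma lookup_free_part:
  "Poly_Mapping.lookup (free_part a j v) i = (if a i \<le> j then form_part (j - a i) (Poly_Mapping.lookup v i) else 0)"
  by (auto simp: free_part_def lookup_mapp when_def in_keys_iff)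

lemma free_part_add: "free_part a j (v + w) = free_part a j v + free_part a j w"
  by (rule poly_mapping_eqI) (simp add: lookup_free_part lookup_add form_part_add)

lemma free_part_in_free_piece:
  assumes "v \<in> free_module n d B"
  shows "free_part a j v \<in> free_piece n d B a j"
proof -
  have "Poly_Mapping.keys (free_part a j v) \<subseteq> Poly_Mapping.keys v"
    unfolding free_part_def by (rule keys_mapp_subset)
  moreover have "a i \<le> j" if "i \<in> Poly_Mapping.keys (free_part a j v)" for i
    using that by (auto simp: in_keys_iff lookup_free_part split: if_splits)
  ultimately show ?thesis
    using assms by (auto simp: free_piece_def free_module_def Sym_def Sym_piece_def lookup_free_part
        intro!: form_part_in_forms)
qed

lemma free_part_free_piece:
  assumes "v \<in> free_piece n d B a j'"
  shows "free_part a j v = (if j = j' then v else 0)"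
proof (rule poly_mapping_eqI)
  fix i
  show "Poly_Mapping.lookup (free_part a j v) i = Poly_Mapping.lookup (if j = j' then v else 0) i"
  proof (cases "i \<in> Poly_Mapping.keys v")
    case True
    then have "a i \<le> j'" "Poly_Mapping.lookup v i \<in> forms (monomials {..n} d) (j' - a i)"
      using assms by (auto simp: free_piece_def Sym_piece_def)
    then show ?thesis by (auto simp: lookup_free_part form_part_forms)
  next
    case False
    then show ?thesis
      by (simp add: lookup_free_part in_keys_iff)
  qed
qed

text \<open>Only finitely many degrees occur, and their sum is a crude bound. Any larger
  \<open>J\<close> is allowed so that the range can be made to contain a prescribed degree.\<close>

lemma sum_free_part:
  fixes v :: "'k::comm_ring_1 free"
  shows "\<exists>N. \<forall>J\<ge>N. v = (\<Sum>j\<le>J. free_part a j v)"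
proof -
  define N where "N = (\<Sum>i\<in>Poly_Mapping.keys v. \<Sum>M\<in>Poly_Mapping.keys (Poly_Mapping.lookup v i). a i + monomial_degree M)"
  have N: "a i + monomial_degree M \<le> N" if "Poly_Mapping.lookup (Poly_Mapping.lookup v i) M \<noteq> 0" for i M
  proof -
    have iM: "i \<in> Poly_Mapping.keys v" "M \<in> Poly_Mapping.keys (Poly_Mapping.lookup v i)"
      using that by (auto simp: in_keys_iff)
    then have "a i + monomial_degree M \<le> (\<Sum>M\<in>Poly_Mapping.keys (Poly_Mapping.lookup v i). a i + monomial_degree M)"
      by (intro member_le_sum) auto
    also have "\<dots> \<le> N" unfolding N_def using iM
      by (intro member_le_sum[where f = "\<lambda>i. \<Sum>M\<in>Poly_Mapping.keys (Poly_Mapping.lookup v i). a i + monomial_degree M"]) auto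
    finally show ?thesis .
  qed
  have "v = (\<Sum>j\<le>J. free_part a j v)" if "N \<le> J" for J
  proof (rule poly_mapping_eqI, rule poly_mapping_eqI)
    fix i M
    let ?c = "Poly_Mapping.lookup (Poly_Mapping.lookup v i) M"
    have "Poly_Mapping.lookup (Poly_Mapping.lookup (\<Sum>j\<le>J. free_part a j v) i) M
        = (\<Sum>j\<le>J. if j = a i + monomial_degree M then ?c else 0)"
      unfolding lookup_sum by (intro sum.cong) (auto simp: lookup_free_part lookup_form_part)
    also have "\<dots> = ?c" using N[of i M] that by (cases "?c = 0") auto
    finally show "?c = Poly_Mapping.lookup (Poly_Mapping.lookup (\<Sum>j\<le>J. free_part a j v) i) M" by simp
  qed
  then show ?thesis by blast
qed

text \<open>The component of degree \<open>j\<close> of a preimage is again a preimage. The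
  projection \<open>Q\<close> to degree \<open>j\<close> in the target is abstract, so that the
  lemma covers both the differentials and the augmentation.\<close>

lemma homogeneous_preimage:
  fixes h :: "'k::comm_ring_1 free \<Rightarrow> 'm::ab_group_add"
  assumes h: "Sym_linear n d (free_module n d B) act h"
    and hom: "\<And>j. h ` free_piece n d B a j \<subseteq> T j"
    and add: "\<And>x y. Q (x + y) = Q x + Q y"
    and Q: "\<And>i x. x \<in> T i \<Longrightarrow> Q x = (if i = j then x else 0)"
    and v: "v \<in> free_module n d B" "h v \<in> T j"
  shows "\<exists>y\<in>free_piece n d B a j. h y = h v"
proof -
  obtain N where N: "v = (\<Sum>j\<le>J. free_part a j v)" if "N \<le> J" for J
    using sum_free_part[of v a] by blast
  define J where "J = max N j"
  have piece: "free_part a i v \<in> free_piece n d B a i" for i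
    using v(1) by (rule free_part_in_free_piece)
  have Q0: "Q 0 = 0" using add[of 0 0] by simp
  have Qsum: "Q (\<Sum>i\<in>I. f i) = (\<Sum>i\<in>I. Q (f i))" if "finite I" for I :: "nat set" and f
    using that by induction (simp_all add: Q0 add)
  have "h v = (\<Sum>i\<le>J. h (free_part a i v))"
    by (subst N[of J]) (auto simp: J_def intro!: Sym_linear_sum[OF h] free_piece_free_module[OF piece])
  then have "Q (h v) = (\<Sum>i\<le>J. Q (h (free_part a i v)))"
    by (simp add: Qsum)
  also have "\<dots> = (\<Sum>i\<le>J. if i = j then h (free_part a j v) else 0)"
    using Q[OF hom[THEN subsetD, OF imageI, OF piece]] by (intro sum.cong) auto
  also have "\<dots> = h (free_part a j v)" by (simp add: J_def)
  finally have "h (free_part a j v) = h v" using v Q by simp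
  with piece show ?thesis by blast
qed

section \<open>Comparison of the resolution with the Koszul complex\<close>

lemma finite_monomials:
  assumes "finite X"
  shows "finite (monomials X e)"
proof -
  have "monomials X e \<subseteq> {m. (\<forall>v. Poly_Mapping.lookup m v \<noteq> 0 \<longrightarrow> v \<in> X) \<and> (\<forall>v. Poly_Mapping.lookup m v \<le> e)}"
  proof
    fix m assume m: "m \<in> monomials X e"
    have "Poly_Mapping.lookup m v \<le> e" for v
    proof (cases "v \<in> Poly_Mapping.keys m")
      case True
      then have "Poly_Mapping.lookup m v \<le> monomial_degree m"
        unfolding monomial_degree_def by (intro member_le_sum) auto
      with m show ?thesis by (simp add: monomials_def)
    qed (simp add: in_keys_iff)
    with m show "m \<in> {m. (\<forall>v. Poly_Mapping.lookup m v \<noteq> 0 \<longrightarrow> v \<in> X) \<and> (\<forall>v. Poly_Mapping.lookup m v \<le> e)}"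
      by (auto simp: monomials_def in_keys_iff)
  qed
  moreover have "finite \<dots>"
  proof (rule finite_imageD[of Poly_Mapping.lookup])
    have "finite {f. \<forall>v. (v \<in> X \<longrightarrow> f v \<in> {..e}) \<and> (v \<notin> X \<longrightarrow> f v = (0::nat))}"
      using assms by (intro finite_set_of_finite_funs) auto
    then show "finite (Poly_Mapping.lookup ` {m. (\<forall>v. Poly_Mapping.lookup m v \<noteq> 0 \<longrightarrow> v \<in> X) \<and> (\<forall>v. Poly_Mapping.lookup m v \<le> e)})"
      by (rule rev_finite_subset) auto
  qed (rule inj_onI, simp add: poly_mapping_eqI)
  ultimately show ?thesis by (rule finite_subset)
qed

lemma Sym_to_sections_var:
  "Sym_to_sections (Poly_Mapping.single (Poly_Mapping.single m 1) c) = Poly_Mapping.single m c"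
proof (cases "c = 0")
  case False
  then show ?thesis by (simp add: Sym_to_sections_def mult_single)
qed (simp add: Sym_to_sections_def)

abbreviation section_koszul ::
    "nat \<Rightarrow> nat \<Rightarrow> ((nat \<Rightarrow>\<^sub>0 nat) set \<Rightarrow> (nat, 'k::comm_ring_1) mpoly) \<Rightarrow> (nat \<Rightarrow>\<^sub>0 nat) set \<Rightarrow> (nat, 'k) mpoly"
  where "section_koszul n d \<equiv> koszul_differential (monomials {..n} d) (\<lambda>s f. Sym_to_sections s * f)"

abbreviation term_koszul ::
    "nat \<Rightarrow> nat \<Rightarrow> ((nat \<Rightarrow>\<^sub>0 nat) set \<Rightarrow> 'k::comm_ring_1 free) \<Rightarrow> (nat \<Rightarrow>\<^sub>0 nat) set \<Rightarrow> 'k free"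
  where "term_koszul n d \<equiv> koszul_differential (monomials {..n} d) free_smult"

text \<open>Exactness of a resolution speaks of whole modules, whereas the chase must keep track of
  degrees; this and the next lemma supply preimages of the right degree.\<close>

lemma diff_graded_lift:
  assumes res: "graded_free_resolution n d E"
    and x: "x \<in> term_piece n d E i j" "x \<in> diff E i ` term_module n d E (Suc i)"
  shows "\<exists>y\<in>term_piece n d E (Suc i) j. diff E i y = x"
proof -
  obtain v where v: "v \<in> term_module n d E (Suc i)" "x = diff E i v" using x by blast
  have "\<exists>y\<in>free_piece n d (gens E (Suc i)) (gdeg E (Suc i)) j. diff E i y = diff E i v"
  proof (rule homogeneous_preimage)
    show "Sym_linear n d (free_module n d (gens E (Suc i))) free_smult (diff E i)"
      using res by (simp add: graded_free_resolution_def term_module_def)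
    show "diff E i ` free_piece n d (gens E (Suc i)) (gdeg E (Suc i)) j \<subseteq> term_piece n d E i j" for j
      using res by (simp add: graded_free_resolution_def term_piece_def)
    show "free_part (gdeg E i) j (x + y) = free_part (gdeg E i) j x + free_part (gdeg E i) j y" for x y :: "'a free"
      by (rule free_part_add)
    show "free_part (gdeg E i) j x = (if i' = j then x else 0)" if "x \<in> term_piece n d E i i'" for i' x
      using that by (auto simp: term_piece_def free_part_free_piece)
  qed (use v x in \<open>auto simp: term_module_def\<close>)
  then show ?thesis by (simp add: v term_piece_def)
qed

lemma aug_graded_lift:
  assumes res: "graded_free_resolution n d E" and d: "d \<ge> 1"
    and x: "x \<in> global_sections n (j * d)"
  shows "\<exists>y\<in>term_piece n d E 0 j. aug E y = x"
proof -
  have "x \<in> section_ring n d" using x by (auto simp: global_sections_def forms_def section_ring_def)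
  also have "section_ring n d = aug E ` term_module n d E 0"
    using res by (simp add: graded_free_resolution_def)
  finally obtain v where v: "v \<in> term_module n d E 0" "x = aug E v" by blast
  have "\<exists>y\<in>free_piece n d (gens E 0) (gdeg E 0) j. aug E y = aug E v"
  proof (rule homogeneous_preimage)
    show "Sym_linear n d (free_module n d (gens E 0)) (\<lambda>s f. Sym_to_sections s * f) (aug E)"
      using res by (simp add: graded_free_resolution_def term_module_def)
    show "aug E ` free_piece n d (gens E 0) (gdeg E 0) j \<subseteq> global_sections n (j * d)" for j
      using res by (simp add: graded_free_resolution_def term_piece_def)
    show "form_part (j * d) (x + y) = form_part (j * d) x + form_part (j * d) y" for x y :: "(nat, 'a) mpoly"
      by (rule form_part_add)
    \<comment> \<open>As \<open>d\<close> is positive, \<open>i * d\<close> determines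
      \<open>i\<close>.\<close>
    show "form_part (j * d) x = (if i = j then x else 0)" if "x \<in> global_sections n (i * d)" for i x
      using that d by (auto simp: global_sections_def form_part_forms)
  qed (use v x in \<open>auto simp: term_module_def\<close>)
  then show ?thesis by (simp add: v term_piece_def)
qed

lemma term_piece_term_module: "x \<in> term_piece n d E i j \<Longrightarrow> x \<in> term_module n d E i"
  by (simp add: term_piece_def term_module_def free_piece_free_module)

text \<open>
  Diagram chase in the double complex with terms \<open>\<Lambda>\<^sup>c V \<otimes> E\<^sub>i\<close>, where \<open>c + i = p\<close>: the columns are
  exact by \<open>koszul_exact_free\<close>, and the chase ends at \<open>i = p\<close> with an element of \<open>E\<^sub>p\<close> of degree
  \<open>p + q\<close>, which lies in \<open>S\<^sub>+ E\<^sub>p\<close> if no basis element has that degree.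
\<close>

lemma koszul_chase:
  fixes E :: "'k::comm_ring_1 free_complex"
  assumes minimal: "minimal_graded_free_resolution n d E"
    and no_gens: "\<And>g. g \<in> gens E p \<Longrightarrow> gdeg E p g \<noteq> p + q"
    and "i + k = p"
    and "\<And>A. A \<subseteq> monomials {..n} d \<Longrightarrow> \<zeta> A \<in> term_piece n d E i (q + i)"
    and "\<And>A. A \<subseteq> monomials {..n} d \<Longrightarrow> card A + i \<noteq> p \<Longrightarrow> \<zeta> A = 0"
    and "\<And>A. A \<subseteq> monomials {..n} d \<Longrightarrow> term_koszul n d \<zeta> A \<in> diff E i ` term_module n d E (Suc i)"
  shows "\<exists>w. \<forall>A\<subseteq>monomials {..n} d. w A \<in> term_module n d E i \<and>
    \<zeta> A - term_koszul n d w A \<in> diff E i ` term_module n d E (Suc i)"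
  using assms(3-)
proof (induction k arbitrary: i \<zeta>)
  case 0
  let ?V = "monomials {..n} d"
  have res: "graded_free_resolution n d E"
    using minimal by (simp add: minimal_graded_free_resolution_def)
  have lin: "Sym_linear n d (free_module n d (gens E (Suc i))) free_smult (diff E i)"
    using res by (simp add: graded_free_resolution_def term_module_def)
  have fin: "finite ?V" by (intro finite_monomials) simp
  \<comment> \<open>Here \<open>i = p\<close>, so \<open>\<zeta>\<close> is supported at the empty
    set, while the differential reads it only at nonempty sets.\<close>
  have "term_koszul n d \<zeta> A = 0" if "A \<subseteq> ?V" for A
    unfolding koszul_differential_def
  proof (rule sum.neutral, rule ballI)
    fix v assume v: "v \<in> ?V - A"
    have "finite A" using that fin finite_subset by blast
    with v have "card (insert v A) + i \<noteq> p" using "0.prems"(1) by simp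
    with v that have "\<zeta> (insert v A) = 0" by (intro "0.prems"(3)) auto
    then show "free_smult (Poly_Mapping.single (Poly_Mapping.single v 1) (koszul_sign v A)) (\<zeta> (insert v A)) = 0"
      by (intro poly_mapping_eqI) simp
  qed
  \<comment> \<open>A nonzero constant term at \<open>g\<close> would force the degree of
    \<open>g\<close> to be \<open>q + i = p + q\<close>, which \<open>no_gens\<close>
    excludes.\<close>
  moreover have "Poly_Mapping.lookup (Poly_Mapping.lookup (\<zeta> {}) g) 0 = 0" for g
  proof (rule ccontr)
    assume nz: "Poly_Mapping.lookup (Poly_Mapping.lookup (\<zeta> {}) g) 0 \<noteq> 0"
    then have g: "g \<in> Poly_Mapping.keys (\<zeta> {})" by (auto simp: in_keys_iff)
    have "\<zeta> {} \<in> term_piece n d E i (q + i)" by (rule "0.prems"(2)) simp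
    with g have "g \<in> gens E i" "gdeg E i g \<le> q + i"
      "Poly_Mapping.lookup (\<zeta> {}) g \<in> forms ?V (q + i - gdeg E i g)"
      by (auto simp: term_piece_def free_piece_def Sym_piece_def)
    moreover from this nz have "monomial_degree (0 :: (nat \<Rightarrow>\<^sub>0 nat) \<Rightarrow>\<^sub>0 nat) = q + i - gdeg E i g"
      by (auto simp: forms_def monomials_def in_keys_iff)
    ultimately show False using no_gens[of g] "0.prems"(1) by (auto simp: monomial_degree_def)
  qed
  ultimately have "\<exists>w. \<forall>A\<subseteq>?V. w A \<in> free_module n d (gens E i) \<and> term_koszul n d w A = \<zeta> A"
    using term_piece_term_module[OF "0.prems"(2)]
    by (intro koszul_exact_free fin) (auto simp: term_module_def)
  then obtain w where w: "\<And>A. A \<subseteq> ?V \<Longrightarrow> w A \<in> free_module n d (gens E i) \<and> term_koszul n d w A = \<zeta> A"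
    by blast
  have "0 \<in> diff E i ` term_module n d E (Suc i)"
    using Sym_linear_0[OF lin] by (auto simp: term_module_def intro!: image_eqI[of _ _ 0])
  then show ?case using w by (intro exI[of _ w]) (simp add: term_module_def)
next
  case (Suc k)
  let ?V = "monomials {..n} d"
  have res: "graded_free_resolution n d E"
    using minimal by (simp add: minimal_graded_free_resolution_def)
  have lin: "Sym_linear n d (free_module n d (gens E (Suc i))) free_smult (diff E i)" for i
    using res by (simp add: graded_free_resolution_def term_module_def)
  have kernel: "v \<in> diff E (Suc i) ` term_module n d E (Suc (Suc i)) \<longleftrightarrow> v \<in> term_module n d E (Suc i) \<and> diff E i v = 0" for v
    using res unfolding graded_free_resolution_def by blast
  have range: "diff E i ` term_module n d E (Suc i) \<subseteq> term_module n d E i"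
    using res unfolding graded_free_resolution_def One_nat_def by (cases i) blast+
  have fin: "finite ?V" by (intro finite_monomials) simp
  have vanish: "term_koszul n d \<zeta> A = 0" if A: "A \<subseteq> ?V" "card A + Suc i \<noteq> p" for A
    unfolding koszul_differential_def
  proof (rule sum.neutral, rule ballI)
    fix v assume v: "v \<in> ?V - A"
    have "finite A" using A fin finite_subset by blast
    with v A have "card (insert v A) + i \<noteq> p" by simp
    with v A have "\<zeta> (insert v A) = 0" by (intro Suc.prems(3)) auto
    then show "free_smult (Poly_Mapping.single (Poly_Mapping.single v 1) (koszul_sign v A)) (\<zeta> (insert v A)) = 0"
      by (intro poly_mapping_eqI) simp
  qed
  \<comment> \<open>Multiplication by a variable raises the degree by one, hence
    \<open>q + Suc i\<close>. In the other exterior degrees the preimage is chosen to be 0: the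
    induction hypothesis demands this, and an arbitrary preimage of 0 may be nonzero.\<close>
  have "\<exists>y. y \<in> term_piece n d E (Suc i) (q + Suc i) \<and> diff E i y = term_koszul n d \<zeta> A \<and>
      (card A + Suc i \<noteq> p \<longrightarrow> y = 0)" if A: "A \<subseteq> ?V" for A
  proof (cases "card A + Suc i = p")
    case True
    have "term_koszul n d \<zeta> A \<in> term_piece n d E i (q + Suc i)"
      using Suc.prems(2) A unfolding term_piece_def add_Suc_right by (intro koszul_differential_free_piece)
    then show ?thesis using diff_graded_lift[OF res _ Suc.prems(4)[OF A]] True by blast
  next
    case False
    then show ?thesis using vanish[OF A] Sym_linear_0[OF lin]
      by (intro exI[of _ 0]) (simp add: term_piece_def)
  qed
  then obtain \<zeta>' where \<zeta>': "\<And>A. A \<subseteq> ?V \<Longrightarrow> \<zeta>' A \<in> term_piece n d E (Suc i) (q + Suc i)"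
      "\<And>A. A \<subseteq> ?V \<Longrightarrow> diff E i (\<zeta>' A) = term_koszul n d \<zeta> A"
      "\<And>A. A \<subseteq> ?V \<Longrightarrow> card A + Suc i \<noteq> p \<Longrightarrow> \<zeta>' A = 0"
    by metis
  have mem': "\<zeta>' A \<in> free_module n d (gens E (Suc i))" if "A \<subseteq> ?V" for A
    using \<zeta>'(1)[OF that] by (auto dest: term_piece_term_module simp: term_module_def)
  have boundary: "term_koszul n d \<zeta>' A \<in> diff E (Suc i) ` term_module n d E (Suc (Suc i))" if A: "A \<subseteq> ?V" for A
    unfolding kernel
  proof
    show "term_koszul n d \<zeta>' A \<in> term_module n d E (Suc i)"
      unfolding term_module_def using mem' A by (intro koszul_differential_free_module)
    have "diff E i (term_koszul n d \<zeta>' A) = term_koszul n d (\<lambda>A. diff E i (\<zeta>' A)) A"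
      using mem' A by (intro Sym_linear_koszul[OF lin])
    also have "\<dots> = term_koszul n d (term_koszul n d \<zeta>) A"
      using \<zeta>'(2) A by (intro koszul_differential_cong) simp
    also have "\<dots> = 0" using fin A by (rule koszul_differential_square_free)
    finally show "diff E i (term_koszul n d \<zeta>' A) = 0" .
  qed
  have "Suc i + k = p" using Suc.prems(1) by simp
  from Suc.IH[OF this \<zeta>'(1,3) boundary]
  obtain w' where w': "\<And>A. A \<subseteq> ?V \<Longrightarrow> w' A \<in> term_module n d E (Suc i)"
      "\<And>A. A \<subseteq> ?V \<Longrightarrow> \<zeta>' A - term_koszul n d w' A \<in> diff E (Suc i) ` term_module n d E (Suc (Suc i))"
    by blast
  have w'_mem: "w' A \<in> free_module n d (gens E (Suc i))" if "A \<subseteq> ?V" for A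
    using w'(1)[OF that] by (simp add: term_module_def)
  \<comment> \<open>Since \<open>\<zeta>'\<close> and the Koszul boundary of \<open>w'\<close> have
    the same image under \<open>diff E i\<close>, subtracting \<open>diff E i (w' A)\<close> turns
    \<open>\<zeta>\<close> into a Koszul cycle without changing it modulo the image of
    \<open>diff E i\<close>.\<close>
  define \<eta> where "\<eta> A = \<zeta> A - diff E i (w' A)" for A
  have \<eta>_mem: "\<eta> A \<in> free_module n d (gens E i)" if A: "A \<subseteq> ?V" for A
    unfolding \<eta>_def
  proof (rule free_module_diff)
    show "\<zeta> A \<in> free_module n d (gens E i)"
      using Suc.prems(2)[OF A] by (auto dest: term_piece_term_module simp: term_module_def)
    show "diff E i (w' A) \<in> free_module n d (gens E i)"
      using w'(1)[OF A] range by (auto simp: term_module_def)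
  qed
  have "\<exists>w. \<forall>A\<subseteq>?V. w A \<in> free_module n d (gens E i) \<and> term_koszul n d w A = \<eta> A"
  proof (rule koszul_exact_free[OF fin \<eta>_mem])
    fix A assume A: "A \<subseteq> ?V"
    have "diff E i (\<zeta>' A - term_koszul n d w' A) = 0"
      using w'(2)[OF A] kernel by blast
    moreover have "term_koszul n d w' A \<in> free_module n d (gens E (Suc i))"
      using w'_mem A by (intro koszul_differential_free_module)
    ultimately have "diff E i (\<zeta>' A) = diff E i (term_koszul n d w' A)"
      using Sym_linear_diff[OF lin mem'[OF A]] by simp
    also have "\<dots> = term_koszul n d (\<lambda>A. diff E i (w' A)) A"
      using w'_mem A by (intro Sym_linear_koszul[OF lin])
    finally have "term_koszul n d \<zeta> A = term_koszul n d (\<lambda>A. diff E i (w' A)) A"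
      using \<zeta>'(2)[OF A] by simp
    then show "term_koszul n d \<eta> A = 0"
      unfolding \<eta>_def koszul_differential_diff_free by simp
  next
    fix g
    \<comment> \<open>The empty set has the wrong exterior degree as long as \<open>i < p\<close>;
      the constant term of the correction vanishes by minimality.\<close>
    have "\<zeta> {} = 0" using Suc.prems(1) by (intro Suc.prems(3)) auto
    moreover have "Poly_Mapping.lookup (diff E i (w' {})) g \<in> irrelevant_ideal n d"
      using minimal w'(1) by (simp add: minimal_graded_free_resolution_def)
    ultimately show "Poly_Mapping.lookup (Poly_Mapping.lookup (\<eta> {}) g) 0 = 0"
      by (simp add: \<eta>_def lookup_minus irrelevant_ideal_def)
  qed
  then obtain w where w: "\<And>A. A \<subseteq> ?V \<Longrightarrow> w A \<in> free_module n d (gens E i) \<and> term_koszul n d w A = \<eta> A"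
    by blast
  show ?case
  proof (intro exI[of _ w] allI impI conjI)
    fix A assume A: "A \<subseteq> ?V"
    show "w A \<in> term_module n d E i" using w[OF A] by (simp add: term_module_def)
    have "\<zeta> A - term_koszul n d w A = diff E i (w' A)" using w[OF A] by (simp add: \<eta>_def)
    then show "\<zeta> A - term_koszul n d w A \<in> diff E i ` term_module n d E (Suc i)"
      using w'(1)[OF A] by simp
  qed
qed

text \<open>A degreewise lift of \<open>z\<close> along \<open>aug E\<close> starts the chase at
  \<open>i = 0\<close>, and the error left by the chase lies in the kernel of \<open>aug E\<close>.
  No degree is asserted for \<open>y\<close>, since later only one coefficient is compared.\<close>

lemma koszul_cycle_is_boundary:
  fixes E :: "'k::comm_ring_1 free_complex" and z :: "(nat \<Rightarrow>\<^sub>0 nat) set \<Rightarrow> (nat, 'k) mpoly"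
  assumes minimal: "minimal_graded_free_resolution n d E" and d: "d \<ge> 1"
    and no_gens: "\<And>g. g \<in> gens E p \<Longrightarrow> gdeg E p g \<noteq> p + q"
    and deg: "\<And>A. A \<subseteq> monomials {..n} d \<Longrightarrow> z A \<in> global_sections n (q * d)"
    and card: "\<And>A. A \<subseteq> monomials {..n} d \<Longrightarrow> card A \<noteq> p \<Longrightarrow> z A = 0"
    and cycle: "\<And>A. A \<subseteq> monomials {..n} d \<Longrightarrow> section_koszul n d z A = 0"
  shows "\<exists>y. \<forall>A\<subseteq>monomials {..n} d. z A = section_koszul n d y A"
proof -
  let ?V = "monomials {..n} d"
  have res: "graded_free_resolution n d E"
    using minimal by (simp add: minimal_graded_free_resolution_def)
  have lin: "Sym_linear n d (free_module n d (gens E 0)) (\<lambda>s f. Sym_to_sections s * f) (aug E)"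
    using res by (simp add: graded_free_resolution_def term_module_def)
  have kernel: "v \<in> diff E 0 ` term_module n d E (Suc 0) \<longleftrightarrow> v \<in> term_module n d E 0 \<and> aug E v = 0" for v
    using res unfolding graded_free_resolution_def One_nat_def by blast
  have "\<exists>x. x \<in> term_piece n d E 0 (q + 0) \<and> aug E x = z A \<and> (card A + 0 \<noteq> p \<longrightarrow> x = 0)" if A: "A \<subseteq> ?V" for A
  proof (cases "card A = p")
    case True
    then show ?thesis using aug_graded_lift[OF res d deg[OF A]] by auto
  next
    case False
    then show ?thesis using card[OF A] Sym_linear_0[OF lin]
      by (intro exI[of _ 0]) (simp add: term_piece_def)
  qed
  then obtain \<zeta> where \<zeta>: "\<And>A. A \<subseteq> ?V \<Longrightarrow> \<zeta> A \<in> term_piece n d E 0 (q + 0)"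
      "\<And>A. A \<subseteq> ?V \<Longrightarrow> aug E (\<zeta> A) = z A" "\<And>A. A \<subseteq> ?V \<Longrightarrow> card A + 0 \<noteq> p \<Longrightarrow> \<zeta> A = 0"
    by metis
  have \<zeta>_mem: "\<zeta> A \<in> free_module n d (gens E 0)" if "A \<subseteq> ?V" for A
    using \<zeta>(1)[OF that] by (auto dest: term_piece_term_module simp: term_module_def)
  have boundary: "term_koszul n d \<zeta> A \<in> diff E 0 ` term_module n d E (Suc 0)" if A: "A \<subseteq> ?V" for A
    unfolding kernel
  proof
    show "term_koszul n d \<zeta> A \<in> term_module n d E 0"
      unfolding term_module_def using \<zeta>_mem A by (intro koszul_differential_free_module)
    have "aug E (term_koszul n d \<zeta> A) = section_koszul n d (\<lambda>A. aug E (\<zeta> A)) A"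
      using \<zeta>_mem A by (intro Sym_linear_koszul[OF lin])
    also have "\<dots> = section_koszul n d z A"
      using \<zeta>(2) A by (intro koszul_differential_cong) simp
    finally show "aug E (term_koszul n d \<zeta> A) = 0" using cycle[OF A] by simp
  qed
  from koszul_chase[OF minimal no_gens add_0 \<zeta>(1,3) boundary]
  obtain w where w: "\<And>A. A \<subseteq> ?V \<Longrightarrow> w A \<in> term_module n d E 0"
      "\<And>A. A \<subseteq> ?V \<Longrightarrow> \<zeta> A - term_koszul n d w A \<in> diff E 0 ` term_module n d E (Suc 0)"
    by blast
  have w_mem: "w A \<in> free_module n d (gens E 0)" if "A \<subseteq> ?V" for A
    using w(1)[OF that] by (simp add: term_module_def)
  show ?thesis
  proof (intro exI[of _ "\<lambda>A. aug E (w A)"] allI impI)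
    fix A assume A: "A \<subseteq> ?V"
    have "aug E (\<zeta> A - term_koszul n d w A) = 0"
      using w(2)[OF A] kernel by blast
    moreover have "term_koszul n d w A \<in> free_module n d (gens E 0)"
      using w_mem A by (intro koszul_differential_free_module)
    ultimately have "z A = aug E (term_koszul n d w A)"
      using Sym_linear_diff[OF lin \<zeta>_mem[OF A]] \<zeta>(2)[OF A] by simp
    also have "\<dots> = section_koszul n d (\<lambda>A. aug E (w A)) A"
      using w_mem A by (intro Sym_linear_koszul[OF lin])
    finally show "z A = section_koszul n d (\<lambda>A. aug E (w A)) A" .
  qed
qed

lemma syzygy_space_nonzero:
  fixes E :: "'k::comm_ring_1 free_complex"
  assumes g: "g \<in> gens E p" "gdeg E p g = p + q"
  shows "syzygy_space E p q \<noteq> {0}"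
proof -
  have "Poly_Mapping.single g 1 \<in> syzygy_space E p q"
    using g unfolding syzygy_space_def
    by (auto simp: lookup_single when_def intro: exI[of _ 0] exI[of _ 1])
  moreover have "Poly_Mapping.single g (1 :: 'k sym) \<noteq> 0"
    by (metis lookup_single_eq lookup_zero zero_neq_one)
  ultimately show ?thesis by auto
qed

section \<open>Counting monomials\<close>

lemma monomial_degree_eq_0: "monomial_degree m = 0 \<longleftrightarrow> m = 0"
proof
  assume "monomial_degree m = 0"
  then show "m = 0"
    by (intro poly_mapping_eqI) (auto simp: monomial_degree_def in_keys_iff)
qed (simp add: monomial_degree_def)

lemma minus_single_add:
  fixes m :: "'v \<Rightarrow>\<^sub>0 nat"
  assumes "k \<le> Poly_Mapping.lookup m x"
  shows "m - Poly_Mapping.single x k + Poly_Mapping.single x k = m"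
  using assms by (intro poly_mapping_eqI) (auto simp: lookup_add lookup_minus lookup_single when_def)

lemma card_monomials_ge:
  assumes "x \<in> X" "k \<le> e"
  shows "card {m \<in> monomials X e. k \<le> Poly_Mapping.lookup m x} = card (monomials X (e - k))"
proof -
  have "bij_betw (\<lambda>m. m + Poly_Mapping.single x k) (monomials X (e - k)) {m \<in> monomials X e. k \<le> Poly_Mapping.lookup m x}"
  proof (rule bij_betw_byWitness[where f' = "\<lambda>m. m - Poly_Mapping.single x k"])
    show "(\<lambda>m. m + Poly_Mapping.single x k) ` monomials X (e - k) \<subseteq> {m \<in> monomials X e. k \<le> Poly_Mapping.lookup m x}"
      using assms by (auto simp: monomials_def monomial_degree_add keys_add_nat lookup_add split: if_splits)
    show "(\<lambda>m. m - Poly_Mapping.single x k) ` {m \<in> monomials X e. k \<le> Poly_Mapping.lookup m x} \<subseteq> monomials X (e - k)"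
    proof (rule image_subsetI)
      fix m assume m: "m \<in> {m \<in> monomials X e. k \<le> Poly_Mapping.lookup m x}"
      define u where "u = m - Poly_Mapping.single x k"
      have "m = u + Poly_Mapping.single x k"
        using m unfolding u_def by (simp add: minus_single_add)
      then have "u \<in> monomials X (e - k)"
        using m by (auto simp: monomials_def monomial_degree_add keys_add_nat)
      then show "m - Poly_Mapping.single x k \<in> monomials X (e - k)" by (simp add: u_def)
    qed
  qed (auto simp: minus_single_add)
  then show ?thesis by (rule bij_betw_same_card [symmetric])
qed

lemma monomial_eq_single:
  assumes "m \<in> monomials X e" "e \<le> Poly_Mapping.lookup m x"
  shows "m = Poly_Mapping.single x e"
proof -
  have m: "m = (m - Poly_Mapping.single x e) + Poly_Mapping.single x e"
    using assms by (simp add: minus_single_add)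
  have "monomial_degree m = monomial_degree (m - Poly_Mapping.single x e) + e"
    by (subst m) (simp add: monomial_degree_add)
  with assms have "m - Poly_Mapping.single x e = 0"
    by (simp add: monomials_def flip: monomial_degree_eq_0)
  with m show ?thesis by simp
qed

text \<open>Pascal's rule: a monomial of positive degree either is divisible by a chosen variable or
  avoids it.\<close>

lemma card_monomials:
  assumes "finite X" "card X = Suc r"
  shows "card (monomials X e) = (e + r) choose r"
  using assms
proof (induction r arbitrary: X e)
  case 0
  then obtain x where X: "X = {x}" by (auto simp: card_1_singleton_iff)
  have "Poly_Mapping.lookup m x = e" if "m \<in> monomials X e" for m
  proof (cases "m = 0")
    case True
    with that show ?thesis by (simp add: monomials_def monomial_degree_def)
  next
    case False
    then have "Poly_Mapping.keys m \<noteq> {}" by simp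
    with that have "Poly_Mapping.keys m = {x}"
      by (simp add: monomials_def X subset_singleton_iff)
    with that show ?thesis by (simp add: monomials_def monomial_degree_def)
  qed
  then have "monomials X e \<subseteq> {Poly_Mapping.single x e}"
    using monomial_eq_single by fastforce
  moreover have "Poly_Mapping.single x e \<in> monomials X e"
    by (simp add: monomials_def X)
  ultimately have "monomials X e = {Poly_Mapping.single x e}" by blast
  then show ?case by simp
next
  case (Suc r)
  obtain x Y where X: "X = insert x Y" "x \<notin> Y" "finite Y" "card Y = Suc r"
    using Suc.prems by (metis card_Suc_eq finite_insert)
  have Y: "card (monomials Y e) = (e + r) choose r" for e
    using X by (intro Suc.IH)
  show ?case
  proof (induction e)
    case 0
    have "monomials X 0 = {0}" by (auto simp: monomials_def monomial_degree_eq_0)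
    then show ?case by simp
  next
    case (Suc e)
    have fin: "finite (monomials X (Suc e))" by (intro finite_monomials) fact
    have "monomials X (Suc e) = {m \<in> monomials X (Suc e). 1 \<le> Poly_Mapping.lookup m x} \<union> monomials Y (Suc e)"
      using X(2) by (auto simp: monomials_def X(1) in_keys_iff Suc_le_eq)
    moreover have "{m \<in> monomials X (Suc e). 1 \<le> Poly_Mapping.lookup m x} \<inter> monomials Y (Suc e) = {}"
      using X(2) by (force simp: monomials_def in_keys_iff subset_iff)
    ultimately have "card (monomials X (Suc e))
        = card {m \<in> monomials X (Suc e). 1 \<le> Poly_Mapping.lookup m x} + card (monomials Y (Suc e))"
      using fin X(3) by (metis card_Un_disjoint finite_Un)
    also have "\<dots> = ((e + Suc r) choose Suc r) + ((Suc e + r) choose r)"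
      using card_monomials_ge[of x X 1 "Suc e"] by (simp only: Suc.IH Y) (simp add: X(1) Suc.IH [unfolded X(1)])
    also have "\<dots> = (Suc e + Suc r) choose Suc r" by simp
    finally show ?case .
  qed
qed

text \<open>In degree \<open>d\<close> an exponent of at least \<open>d\<close> forces a pure power.
  So the complement consists of the multiples of x^k and the \<open>r\<close> powers of the other
  variables, disjoint because \<open>k\<close> is positive. The additive form avoids truncated
  subtraction.\<close>

lemma card_bounded_monomials:
  assumes X: "finite X" "card X = Suc r" "x \<in> X" and k: "1 \<le> k" "k \<le> d"
  shows "card {m \<in> monomials X d. Poly_Mapping.lookup m x < k \<and> (\<forall>t\<in>X - {x}. Poly_Mapping.lookup m t < d)}
    + ((d - k + r) choose r) + r = (d + r) choose r"
proof -
  define S where "S = {m \<in> monomials X d. Poly_Mapping.lookup m x < k \<and> (\<forall>t\<in>X - {x}. Poly_Mapping.lookup m t < d)}"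
  define G where "G = {m \<in> monomials X d. k \<le> Poly_Mapping.lookup m x}"
  define P where "P = (\<lambda>t. Poly_Mapping.single t d) ` (X - {x})"
  have fin: "finite (monomials X d)" using X by (intro finite_monomials)
  have P: "P \<subseteq> monomials X d" by (auto simp: P_def monomials_def split: if_splits)
  have "monomials X d = S \<union> (G \<union> P)"
    using P monomial_eq_single by (fastforce simp: S_def G_def P_def not_less)
  moreover have "S \<inter> G = {}" by (auto simp: S_def G_def)
  moreover have "m \<notin> S" if "m \<in> P" for m
  proof -
    obtain t where "t \<in> X - {x}" "m = Poly_Mapping.single t d"
      using \<open>m \<in> P\<close> unfolding P_def by blast
    then show ?thesis by (auto simp: S_def intro!: bexI[of _ t])
  qed
  moreover have "G \<inter> P = {}" using k by (auto simp: G_def P_def lookup_single when_def split: if_splits)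
  moreover have "finite S" "finite G" "finite P" using fin X by (auto simp: S_def G_def P_def)
  ultimately have "card (monomials X d) = card S + (card G + card P)"
    using card_Un_disjoint[of S "G \<union> P"] card_Un_disjoint[of G P] by fastforce
  moreover have "card G = (d - k + r) choose r"
    unfolding G_def using X k by (simp add: card_monomials_ge card_monomials)
  moreover have "card P = r"
  proof -
    have "inj_on (\<lambda>t. Poly_Mapping.single t d) (X - {x})"
    proof (rule inj_onI)
      fix s t assume "Poly_Mapping.single s d = Poly_Mapping.single t d"
      then have "Poly_Mapping.keys (Poly_Mapping.single s d) = Poly_Mapping.keys (Poly_Mapping.single t d)" by simp
      then show "s = t" using k by simp
    qed
    then show ?thesis using X by (simp add: P_def card_image)
  qed
  ultimately show ?thesis using X by (simp add: card_monomials S_def)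
qed

section \<open>The nonzero class\<close>

lemma single_sum: "Poly_Mapping.single k (sum f A) = (\<Sum>a\<in>A. Poly_Mapping.single k (f a))"
  by (induction A rule: infinite_finite_induct) (simp_all add: single_add)

text \<open>Monomials are exponent vectors, so \<open>\<Sum>A\<close> is the product of
  \<open>A\<close>. Injectivity of \<open>g\<close> on \<open>I\<close> lets each variable receive
  at most one new d-th power, which the exponents in the replaced \<open>a\<close> and in
  \<open>f\<close> together pay for.\<close>

lemma exchange_divides:
  fixes A :: "('v \<Rightarrow>\<^sub>0 nat) set" and j :: "('v \<Rightarrow>\<^sub>0 nat) \<Rightarrow> 'v" and d :: nat
  defines "g \<equiv> \<lambda>a. Poly_Mapping.single (j a) d"
  assumes fin: "finite A" and I: "I \<subseteq> A" "inj_on g I" and disj: "g ` A \<inter> A = {}"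
    and ann: "\<And>a. a \<in> A \<Longrightarrow> d \<le> Poly_Mapping.lookup a (j a) + Poly_Mapping.lookup f (j a)"
  shows "Poly_Mapping.lookup (\<Sum>((A - I) \<union> g ` I)) t \<le> Poly_Mapping.lookup (f + \<Sum>A) t"
proof -
  have finI: "finite I" using I fin finite_subset by blast
  have "(\<Sum>i\<in>I. Poly_Mapping.lookup (g i) t) \<le> Poly_Mapping.lookup f t + (\<Sum>i\<in>I. Poly_Mapping.lookup i t)"
  proof (cases "\<exists>i\<in>I. j i = t")
    case True
    then obtain i where i: "i \<in> I" "j i = t" by blast
    have "Poly_Mapping.lookup (g i') t = 0" if "i' \<in> I - {i}" for i'
      using that i inj_onD[OF I(2), of i' i] by (auto simp: g_def lookup_single when_def)
    then have "(\<Sum>i\<in>I. Poly_Mapping.lookup (g i) t) = Poly_Mapping.lookup (g i) t"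
      using finI i(1) by (simp add: sum.remove)
    also have "\<dots> \<le> Poly_Mapping.lookup f t + Poly_Mapping.lookup i t"
      using ann[of i] i I by (auto simp: g_def)
    also have "Poly_Mapping.lookup i t \<le> (\<Sum>i\<in>I. Poly_Mapping.lookup i t)"
      using finI i(1) by (intro member_le_sum) auto
    finally show ?thesis by simp
  next
    case False
    then show ?thesis by (simp add: g_def lookup_single when_def)
  qed
  moreover have "(\<Sum>b\<in>(A - I) \<union> g ` I. Poly_Mapping.lookup b t)
      = (\<Sum>a\<in>A - I. Poly_Mapping.lookup a t) + (\<Sum>i\<in>I. Poly_Mapping.lookup (g i) t)"
    using fin finI I disj by (subst sum.union_disjoint) (auto simp: sum.reindex)
  moreover have "(\<Sum>a\<in>A. Poly_Mapping.lookup a t)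
      = (\<Sum>a\<in>A - I. Poly_Mapping.lookup a t) + (\<Sum>a\<in>I. Poly_Mapping.lookup a t)"
    by (rule sum.subset_diff[OF I(1) fin])
  ultimately show ?thesis by (simp add: lookup_sum lookup_add)
qed

lemma monomial_degree_sum:
  "B \<subseteq> monomials X d \<Longrightarrow> finite B \<Longrightarrow> monomial_degree (\<Sum>B) = card B * d"
proof (induction B rule: infinite_finite_induct)
  case empty
  show ?case by (simp add: monomial_degree_def)
next
  case (insert b B)
  then show ?case by (simp add: monomial_degree_add monomials_def)
qed simp

text \<open>
  Modulo the regular sequence \<open>x\<^sub>0\<^sup>d, \<dots>, x\<^sub>n\<^sup>d\<close> the wedge of the elements of \<open>A\<close>, tensored with
  \<open>f\<close>, is a Koszul cycle. Its lift to \<open>R\<close> used here is \<open>f\<close> times the product of the factors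
  \<open>e\<^sub>a - (a / x\<^sub>t\<^sup>d) e\<close>, where \<open>a\<close> ranges over \<open>A\<close>, \<open>t = j a\<close>, and \<open>e\<close> is the generator belonging
  to \<open>x\<^sub>t\<^sup>d\<close>. The lift is homogeneous of multidegree \<open>f\<close> times the product of \<open>A\<close>, hence is determined
  by the scalar cycle \<open>c\<close>; the denominators cancel because \<open>x\<^sub>t\<^sup>d\<close> divides \<open>a f\<close>.
\<close>

lemma syzygy_space_nonzero_of_monomial:
  fixes E :: "'k::field free_complex"
  assumes minimal: "minimal_graded_free_resolution n d E" and d: "1 \<le> d"
    and f: "f \<in> monomials {..n} (q * d)"
    and A: "A \<subseteq> monomials {..n} d"
    and ann: "\<And>a. a \<in> A \<Longrightarrow> \<exists>t\<le>n. d \<le> Poly_Mapping.lookup a t + Poly_Mapping.lookup f t"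
    and no_powers: "\<And>t. t \<le> n \<Longrightarrow> Poly_Mapping.single t d \<notin> A"
    and divisors: "\<And>m. m \<in> monomials {..n} d \<Longrightarrow> (\<And>t. Poly_Mapping.lookup m t \<le> Poly_Mapping.lookup f t) \<Longrightarrow> m \<in> A"
  shows "syzygy_space E (card A) q \<noteq> {0}"
proof (rule ccontr)
  assume "\<not> syzygy_space E (card A) q \<noteq> {0}"
  then have no_gens: "gdeg E (card A) i \<noteq> card A + q" if "i \<in> gens E (card A)" for i
    using syzygy_space_nonzero that by blast
  let ?V = "monomials {..n} d"
  have finV: "finite ?V" by (intro finite_monomials) simp
  have finA: "finite A" using A finV finite_subset by blast
  obtain j where j: "\<And>a. a \<in> A \<Longrightarrow> j a \<le> n"
    "\<And>a. a \<in> A \<Longrightarrow> d \<le> Poly_Mapping.lookup a (j a) + Poly_Mapping.lookup f (j a)"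
    using ann by metis
  define g where "g = (\<lambda>a :: nat \<Rightarrow>\<^sub>0 nat. Poly_Mapping.single (j a) d)"
  have gV: "g ` A \<subseteq> ?V" using j d by (auto simp: g_def monomials_def split: if_splits)
  \<comment> \<open>Excluding pure powers from \<open>A\<close> ensures that every exchange brings
    in a new exterior generator.\<close>
  have disj: "g ` A \<inter> A = {}" using j no_powers by (auto simp: g_def)
  obtain c :: "(nat \<Rightarrow>\<^sub>0 nat) set \<Rightarrow> 'k" where c: "\<And>B. B \<subseteq> ?V \<Longrightarrow> scalar_differential ?V c B = 0"
    and cA: "c A * c A = 1"
    and supp: "\<And>B. c B \<noteq> 0 \<Longrightarrow> \<exists>I\<subseteq>A. inj_on g I \<and> B = (A - I) \<union> g ` I"
    using exists_scalar_cycle[OF finV A gV disj] by metis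
  define F where "F = f + \<Sum>A"
  have div: "Poly_Mapping.lookup (\<Sum>B) t \<le> Poly_Mapping.lookup F t" if "c B \<noteq> 0" for B t
    using supp[OF that] exchange_divides[OF finA _ _ _ j(2)] disj by (auto simp: g_def F_def)
  have card: "card B = card A" if nz: "c B \<noteq> 0" for B
  proof -
    obtain I where I: "I \<subseteq> A" "inj_on g I" "B = (A - I) \<union> g ` I" using supp[OF nz] by blast
    have "finite I" using I finA finite_subset by blast
    then have "card B = card (A - I) + card (g ` I)"
      unfolding I(3) using disj I(1) finA by (intro card_Un_disjoint) auto
    also have "\<dots> = card A"
      using I \<open>finite I\<close> finA by (simp add: card_image card_Diff_subset card_mono)
    finally show ?thesis .
  qed
  \<comment> \<open>The truncated difference is the true quotient wherever \<open>c B\<close> is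
    nonzero, by \<open>div\<close>; elsewhere the coefficient is 0.\<close>
  define z where "z B = Poly_Mapping.single (F - \<Sum>B) (c B)" for B
  have "z B \<in> global_sections n (q * d)" if B: "B \<subseteq> ?V" for B
  proof (cases "c B = 0")
    case True
    then show ?thesis by (simp add: z_def global_sections_def)
  next
    case False
    have finB: "finite B" using B finV finite_subset by blast
    have F: "F = (F - \<Sum>B) + \<Sum>B"
      using div[OF False] by (intro poly_mapping_eqI) (simp add: lookup_add lookup_minus)
    have "monomial_degree F = q * d + card A * d"
      using f A finA by (simp add: F_def monomial_degree_add monomial_degree_sum monomials_def[of _ "q * d"])
    moreover have "monomial_degree F = monomial_degree (F - \<Sum>B) + card A * d"
      by (subst F) (simp add: monomial_degree_add monomial_degree_sum[OF B finB] card[OF False])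
    ultimately have deg: "monomial_degree (F - \<Sum>B) = q * d" by simp
    have "Poly_Mapping.keys (F - \<Sum>B) \<subseteq> Poly_Mapping.keys F"
      by (subst (2) F) (simp add: keys_add_nat)
    also have "\<dots> \<subseteq> {..n}"
    proof -
      have "Poly_Mapping.keys (\<Sum>A) \<subseteq> (\<Union>a\<in>A. Poly_Mapping.keys a)" by (rule keys_sum)
      also have "\<dots> \<subseteq> {..n}" using A by (auto simp: monomials_def)
      finally show ?thesis using f by (auto simp: F_def keys_add_nat monomials_def)
    qed
    finally show ?thesis using False deg by (simp add: z_def global_sections_def forms_def monomials_def)
  qed
  moreover have "z B = 0" if "card B \<noteq> card A" for B
    using that card[of B] by (cases "c B = 0") (auto simp: z_def)
  moreover have "section_koszul n d z B = 0" if B: "B \<subseteq> ?V" for B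
  proof -
    have finB: "finite B" using B finV finite_subset by blast
    \<comment> \<open>Multiplying by \<open>v\<close> restores the factor removed with
      \<open>insert v B\<close>, so all terms share one monomial and only scalars are added.\<close>
    have "section_koszul n d z B = (\<Sum>v\<in>?V - B. Poly_Mapping.single (F - \<Sum>B) (koszul_sign v B * c (insert v B)))"
      unfolding koszul_differential_def
    proof (rule sum.cong)
      fix v assume v: "v \<in> ?V - B"
      show "Sym_to_sections (Poly_Mapping.single (Poly_Mapping.single v 1) (koszul_sign v B)) * z (insert v B)
          = Poly_Mapping.single (F - \<Sum>B) (koszul_sign v B * c (insert v B))"
      proof (cases "c (insert v B) = 0")
        case False
        have sum: "\<Sum>(insert v B) = v + \<Sum>B" using v finB by simp
        have "v + (F - \<Sum>(insert v B)) = F - \<Sum>B"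
        proof (rule poly_mapping_eqI)
          fix t
          have "Poly_Mapping.lookup v t + Poly_Mapping.lookup (\<Sum>B) t \<le> Poly_Mapping.lookup F t"
            using div[OF False, of t] unfolding sum by (simp add: lookup_add)
          then show "Poly_Mapping.lookup (v + (F - \<Sum>(insert v B))) t = Poly_Mapping.lookup (F - \<Sum>B) t"
            unfolding sum lookup_add lookup_minus by simp
        qed
        then show ?thesis unfolding z_def Sym_to_sections_var mult_single by simp
      qed (simp add: z_def)
    qed simp
    also have "\<dots> = Poly_Mapping.single (F - \<Sum>B) (scalar_differential ?V c B)"
      by (simp add: scalar_differential_def single_sum)
    also have "\<dots> = 0" by (simp add: c[OF B])
    finally show ?thesis .
  qed
  ultimately obtain y where y: "\<And>B. B \<subseteq> ?V \<Longrightarrow> z B = section_koszul n d y B"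
    using koszul_cycle_is_boundary[OF minimal d no_gens, of z] by metis
  \<comment> \<open>This holds for arbitrary \<open>y\<close>, whereas \<open>z A\<close> has at
    \<open>f\<close> the coefficient \<open>c A\<close>, which is nonzero because its square is
    1.\<close>
  have "Poly_Mapping.lookup (section_koszul n d y A) f = 0"
    unfolding koszul_differential_def lookup_sum Sym_to_sections_var
  proof (rule sum.neutral, rule ballI, rule lookup_single_mult_eq_0)
    fix v u assume "v \<in> ?V - A"
    then show "f \<noteq> v + u" using divisors[of v] by (auto simp: lookup_add)
  qed
  moreover have "Poly_Mapping.lookup (z A) f = c A"
    by (simp add: z_def F_def)
  ultimately show False using y[OF A] cA by simp
qed

section \<open>The monomial and the two bounds on \<open>p\<close>\<close>

theorem theorem2:
  fixes n q :: nat
  assumes "1 \<le> q" and "q \<le> n"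
  shows "\<exists>d0. \<forall>d\<ge>d0. \<forall>p.
    int ((d + q) choose q) - int ((d - 1) choose q) - int q \<le> int p \<and>
    int p \<le> int ((d + n) choose n) - int ((d + n - q) choose (n - q)) + int (n choose (n - q)) - int q - 1
    \<longrightarrow> (\<forall>E :: 'k::alg_closed_field free_complex.
          minimal_graded_free_resolution n d E \<longrightarrow> syzygy_space E p q \<noteq> {0})"
proof (intro exI[of _ "q + 1"] allI impI, elim conjE)
  fix d p and E :: "'k free_complex"
  assume "q + 1 \<le> d"
    and p1: "int ((d + q) choose q) - int ((d - 1) choose q) - int q \<le> int p"
    and p2: "int p \<le> int ((d + n) choose n) - int ((d + n - q) choose (n - q)) + int (n choose (n - q)) - int q - 1"
    and minimal: "minimal_graded_free_resolution n d E"
  then have d: "q < d" by simp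
  let ?V = "monomials {..n} d"
  have finV: "finite ?V" by (intro finite_monomials) simp
  define f :: "nat \<Rightarrow>\<^sub>0 nat" where "f = (\<Sum>t<q. Poly_Mapping.single t (d - 1)) + Poly_Mapping.single q q"
  have f: "Poly_Mapping.lookup f t = (if t < q then d - 1 else if t = q then q else 0)" for t
    by (auto simp: f_def lookup_add lookup_sum lookup_single when_def)
  have f_mon: "f \<in> monomials {..n} (q * d)"
  proof -
    have keys: "Poly_Mapping.keys f \<subseteq> {..q}"
      by (auto simp: in_keys_iff f split: if_splits)
    have "monomial_degree f = (\<Sum>t\<le>q. Poly_Mapping.lookup f t)"
      unfolding monomial_degree_def using keys by (intro sum.mono_neutral_left) (auto simp: in_keys_iff)
    also have "\<dots> = (\<Sum>t<q. d - 1) + q"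
      by (simp add: lessThan_Suc_atMost [symmetric] f)
    also have "\<dots> = q * d" using d by (cases d) auto
    finally show ?thesis using keys assms by (auto simp: monomials_def)
  qed
  \<comment> \<open>\<open>D\<close> holds the divisors of \<open>f\<close>, \<open>N\<close> the
    monomials that do not annihilate it modulo d-th powers, \<open>P\<close> the pure powers. The
    set \<open>A\<close> will be chosen between \<open>D\<close> and \<open>Z\<close>.\<close>
  define D where "D = {m \<in> ?V. \<forall>t. Poly_Mapping.lookup m t \<le> Poly_Mapping.lookup f t}"
  define N where "N = {m \<in> ?V. \<forall>t\<le>n. Poly_Mapping.lookup m t + Poly_Mapping.lookup f t < d}"
  define P where "P = (\<lambda>t. Poly_Mapping.single t d) ` {..n}"
  define Z where "Z = ?V - (N \<union> P)"
  \<comment> \<open>The bound d - 1 on the other exponents excludes just the pure powers; the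
    exponent of x_q is at most q, so the count applies with \<open>k = q + 1\<close>.\<close>
  have "D = {m \<in> monomials {..q} d. Poly_Mapping.lookup m q < q + 1 \<and> (\<forall>t\<in>{..q} - {q}. Poly_Mapping.lookup m t < d)}"
    (is "_ = ?D")
  proof (intro equalityI subsetI)
    fix m assume m: "m \<in> D"
    then have le: "Poly_Mapping.lookup m t \<le> Poly_Mapping.lookup f t" for t by (simp add: D_def)
    have "t \<le> q" if "t \<in> Poly_Mapping.keys m" for t
      using le[of t] that by (auto simp: f in_keys_iff split: if_splits)
    moreover have "Poly_Mapping.lookup m t < d" if "t < q" for t
      using le[of t] that d by (auto simp: f)
    ultimately show "m \<in> ?D" using m le[of q] by (auto simp: D_def monomials_def f)
  next
    fix m assume m: "m \<in> ?D"
    have "Poly_Mapping.lookup m t \<le> Poly_Mapping.lookup f t" for t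
    proof -
      consider "t < q" | "t = q" | "q < t" by linarith
      then show ?thesis
      proof cases
        case 1
        with m have "Poly_Mapping.lookup m t < d" by auto
        with 1 show ?thesis by (simp add: f)
      next
        case 2
        with m show ?thesis by (simp add: f)
      next
        case 3
        with m have "t \<notin> Poly_Mapping.keys m" by (auto simp: monomials_def)
        then show ?thesis by (simp add: in_keys_iff)
      qed
    qed
    then show "m \<in> D" using m assms by (auto simp: D_def monomials_def)
  qed
  then have "card D + ((d - (q + 1) + q) choose q) + q = (d + q) choose q"
    using card_bounded_monomials[of "{..q}" q q "q + 1" d] d by simp
  moreover have "d - (q + 1) + q = d - 1" using d by simp
  ultimately have card_D: "card D + ((d - 1) choose q) + q = (d + q) choose q" by simp
  \<comment> \<open>An exponent d - 1 in \<open>f\<close> forces exponent 0 in \<open>m\<close>, and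
    at x_q there is room for less than d - q, so the count applies with
    \<open>k = d - q\<close>.\<close>
  have "N = {m \<in> monomials {q..n} d. Poly_Mapping.lookup m q < d - q \<and> (\<forall>t\<in>{q..n} - {q}. Poly_Mapping.lookup m t < d)}"
    (is "_ = ?N")
  proof (intro equalityI subsetI)
    fix m assume m: "m \<in> N"
    then have le: "Poly_Mapping.lookup m t + Poly_Mapping.lookup f t < d" if "t \<le> n" for t
      using that by (simp add: N_def)
    have "q \<le> t" if "t \<in> Poly_Mapping.keys m" for t
    proof (rule ccontr)
      assume "\<not> q \<le> t"
      then show False using le[of t] that assms by (auto simp: f in_keys_iff)
    qed
    moreover have "Poly_Mapping.lookup m t < d" if "t \<le> n" for t
      using le[OF that] by simp
    ultimately show "m \<in> ?N" using m le[of q] assms by (auto simp: N_def monomials_def f)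
  next
    fix m assume m: "m \<in> ?N"
    have "Poly_Mapping.lookup m t + Poly_Mapping.lookup f t < d" if "t \<le> n" for t
    proof -
      consider "t < q" | "t = q" | "q < t" by linarith
      then show ?thesis
      proof cases
        case 1
        with m have "t \<notin> Poly_Mapping.keys m" by (auto simp: monomials_def)
        then show ?thesis using 1 d by (simp add: f in_keys_iff)
      next
        case 2
        with m show ?thesis by (auto simp: f)
      next
        case 3
        with m that show ?thesis by (auto simp: f)
      qed
    qed
    then show "m \<in> N" using m by (auto simp: N_def monomials_def)
  qed
  then have "card N + ((d - (d - q) + (n - q)) choose (n - q)) + (n - q) = (d + (n - q)) choose (n - q)"
    using card_bounded_monomials[of "{q..n}" "n - q" q "d - q" d] d assms by (simp add: Suc_diff_le)
  moreover have "d - (d - q) + (n - q) = n" "d + (n - q) = d + n - q" using d assms by auto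
  ultimately have card_N: "card N + (n choose (n - q)) + (n - q) = (d + n - q) choose (n - q)" by simp
  have "card ?V = (d + n) choose n" by (intro card_monomials) auto
  moreover have "card Z + (card N + (n + 1)) = card ?V"
  proof -
    have "inj_on (\<lambda>t. Poly_Mapping.single t d) {..n}"
    proof (rule inj_onI)
      fix s t assume "Poly_Mapping.single s d = Poly_Mapping.single t d"
      then have "Poly_Mapping.keys (Poly_Mapping.single s d) = Poly_Mapping.keys (Poly_Mapping.single t d)" by simp
      then show "s = t" using d by simp
    qed
    then have "card P = n + 1" by (simp add: P_def card_image)
    moreover have "N \<inter> P = {}" by (auto simp: N_def P_def)
    moreover have "N \<union> P \<subseteq> ?V" using d by (auto simp: N_def P_def monomials_def split: if_splits)
    ultimately show ?thesis
      using finV finite_subset[OF _ finV] card_mono[OF finV, of "N \<union> P"]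
      by (simp add: Z_def card_Diff_subset card_Un_disjoint)
  qed
  \<comment> \<open>The constant -q - 1 arises as (n - q) - (n + 1): all n + 1 pure powers are
    removed, and n - q powers were already subtracted in the count of \<open>N\<close>.\<close>
  ultimately have "p \<le> card Z" using p2 card_N assms by linarith
  moreover have "card D \<le> p" using p1 card_D by linarith
  moreover have "D \<subseteq> Z"
  proof
    fix m assume m: "m \<in> D"
    then have le: "Poly_Mapping.lookup m t \<le> Poly_Mapping.lookup f t" for t by (simp add: D_def)
    have "m \<notin> P"
    proof
      assume "m \<in> P"
      then obtain t where "m = Poly_Mapping.single t d" by (auto simp: P_def)
      with le[of t] d show False by (auto simp: f split: if_splits)
    qed
    moreover have "m \<notin> N"
    proof
      assume "m \<in> N"
      \<comment> \<open>Membership in \<open>D\<close> rules out variables beyond x_q and membership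
        in \<open>N\<close> those before it; what remains is x_q^d, which does not divide
        \<open>f\<close> as q < d.\<close>
      have "Poly_Mapping.keys m \<subseteq> {q}"
      proof
        fix t assume t: "t \<in> Poly_Mapping.keys m"
        show "t \<in> {q}"
        proof (rule ccontr)
          assume "t \<notin> {q}"
          moreover have "t \<le> q" using le[of t] t by (auto simp: f in_keys_iff split: if_splits)
          ultimately have "t < q" by simp
          moreover from this have "Poly_Mapping.lookup m t + Poly_Mapping.lookup f t < d"
            using \<open>m \<in> N\<close> assms by (auto simp: N_def)
          ultimately show False using t by (auto simp: f in_keys_iff)
        qed
      qed
      then have "monomial_degree m = (\<Sum>t\<in>{q}. Poly_Mapping.lookup m t)"
        unfolding monomial_degree_def by (intro sum.mono_neutral_left) (auto simp: in_keys_iff)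
      moreover have "monomial_degree m = d" using m by (simp add: D_def monomials_def)
      ultimately show False using le[of q] d by (simp add: f)
    qed
    ultimately show "m \<in> Z" using m by (simp add: Z_def D_def)
  qed
  moreover have "finite Z" using finV by (simp add: Z_def)
  ultimately obtain A where A: "D \<subseteq> A" "A \<subseteq> Z" "card A = p"
    using exists_subset_between by metis
  have "syzygy_space E (card A) q \<noteq> {0}"
  proof (rule syzygy_space_nonzero_of_monomial[OF minimal _ f_mon])
    show "1 \<le> d" using d by simp
    show "A \<subseteq> ?V" using A by (auto simp: Z_def)
    show "\<exists>t\<le>n. d \<le> Poly_Mapping.lookup a t + Poly_Mapping.lookup f t" if "a \<in> A" for a
      using that A by (force simp: Z_def N_def not_less)
    show "Poly_Mapping.single t d \<notin> A" if "t \<le> n" for t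
      using that A by (auto simp: Z_def P_def)
    show "m \<in> A" if "m \<in> ?V" "\<And>t. Poly_Mapping.lookup m t \<le> Poly_Mapping.lookup f t" for m
      using that A by (auto simp: D_def)
  qed
  then show "syzygy_space E p q \<noteq> {0}" by (simp add: A)
qed

end
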